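(* Let $G$ be a finite simple planar graph with at least one vertex such that no triangle of $G$ shares an edge with another triangle of $G$ or with a cycle of length $5$ in $G$. Then $\frac{|V(G)|}{\alpha(G)} \le 4 - \frac{2}{9}$, where $\alpha(G)$ is the independence number of $G$.
   Context: The independence number $\alpha(G)$ is the maximum size of an independent set of $G$; $|V(G)|/\alpha(G)$ is the independence ratio. Two cycles are called adjacent if they have a common edge; the hypothesis says $G$ has no triangle adjacent to a cycle of length three or five. *)

theory Defs
  imports "HOL-Analysis.Analysis" "Graph_Theory.Pair_Digraph"
begin

text \<open>
  A finite simple graph is a \<^locale>\<open>pair_graph\<close>: a finite vertex set with a symmetric,
  irreflexive set of ordered pairs. An undirected edge thus corresponds to two opposite arcs;
  \<open>edge_set\<close> forgets the orientation.
\<close>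

definition edge_set :: "('a \<times> 'a) set \<Rightarrow> 'a set set" where
  "edge_set A = (\<lambda>(u, v). {u, v}) ` A"

text \<open>
  In a symmetric digraph the library's cycles include the closed walks \<open>u, v, u\<close> of length 2,
  which are not cycles of the undirected graph. For lengths at least 3 the library's cycles are
  exactly the cycles of the undirected graph, each occurring once for every choice of starting
  vertex and direction.
\<close>

definition cycle_of_length :: "'a pair_pre_digraph \<Rightarrow> nat \<Rightarrow> ('a \<times> 'a) list \<Rightarrow> bool" where
  "cycle_of_length G k p \<longleftrightarrow> 3 \<le> k \<and> pre_digraph.cycle (with_proj G) p \<and> length p = k"

text \<open>
  The inequality of edge sets says that the two cycles are different as subgraphs, not merely
  different traversals of one cycle.
\<close>

definition adjacent_cycles :: "('a \<times> 'a) list \<Rightarrow> ('a \<times> 'a) list \<Rightarrow> bool" where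
  "adjacent_cycles p q \<longleftrightarrow>
     edge_set (set p) \<noteq> edge_set (set q) \<and> edge_set (set p) \<inter> edge_set (set q) \<noteq> {}"

definition independent_set :: "'a pair_pre_digraph \<Rightarrow> 'a set \<Rightarrow> bool" where
  "independent_set G S \<longleftrightarrow> S \<subseteq> pverts G \<and> (\<forall>u\<in>S. \<forall>v\<in>S. (u, v) \<notin> parcs G)"

definition independence_number :: "'a pair_pre_digraph \<Rightarrow> nat" where
  "independence_number G = Max {card S | S. independent_set G S}"

text \<open>
  A plane drawing places the vertices at distinct points \<open>f v\<close> and draws each undirected edge \<open>e\<close>
  as an arc \<open>\<gamma> e\<close> joining its endpoints, such that the interior of an edge contains no vertex
  and no point of any other edge. The plane is the type \<^typ>\<open>complex\<close>.
\<close>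

definition plane_drawing ::
    "'a pair_pre_digraph \<Rightarrow> ('a \<Rightarrow> complex) \<Rightarrow> ('a set \<Rightarrow> real \<Rightarrow> complex) \<Rightarrow> bool" where
  "plane_drawing G f \<gamma> \<longleftrightarrow>
     inj_on f (pverts G) \<and>
     (\<forall>e \<in> edge_set (parcs G).
        arc (\<gamma> e) \<and>
        {pathstart (\<gamma> e), pathfinish (\<gamma> e)} = f ` e \<and>
        (path_image (\<gamma> e) - f ` e) \<inter> f ` pverts G = {} \<and>
        (\<forall>e' \<in> edge_set (parcs G). e' \<noteq> e \<longrightarrow>
           (path_image (\<gamma> e) - f ` e) \<inter> path_image (\<gamma> e') = {}))"

definition planar :: "'a pair_pre_digraph \<Rightarrow> bool" where
  "planar G \<longleftrightarrow> (\<exists>f \<gamma>. plane_drawing G f \<gamma>)"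

end

theory Submission
  imports Defs
begin

text \<open>
  Every triangle edge lies on no other cycle of length at most five: a 4-cycle sharing an edge with
  a triangle would produce a 5-cycle or a second triangle sharing an edge with it. Hence, across each
  of its edges, a triangular face meets a face with at least six boundary edges. Letting every edge
  give \<open>1 / b(F)\<close> to each face \<open>F\<close> beside it, where \<open>b(F)\<close> counts the boundary edges of \<open>F\<close>,
  every edge gives at most \<open>1/3 + 1/6 = 1/4 + 1/4 = 1/2\<close>, so there are at most \<open>|E| / 2\<close>
  faces, and Euler's formula yields \<open>|E| < 2 |V|\<close> for the graph and all its induced subgraphs.

  An induction that removes closed neighbourhoods of vertices of degree at most three then gives
  \<open>102 \<alpha>(G) \<ge> 41 |V| - 7 |E| \<ge> 27 |V|\<close>. The coefficients come from the isolated triangle, where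
  \<open>3 \<cdot> 41 - 3 \<cdot> 7 = 102\<close>, and from the target \<open>27/102 = 9/34\<close>.
\<close>

section \<open>Reachability and bridges\<close>

text \<open>A face boundary need not be a cycle: the graph may be disconnected or have cut vertices
  and bridges. Facial walks are therefore avoided. A face is a component of the complement of the
  drawing, and an edge lies on its boundary if deleting that edge destroys the face. The face
  survives in the drawing of its boundary edges alone, so cycles of bounded length are found there
  by looking for non-bridges. The topological core is the number of faces beside an edge: one for a
  bridge, two otherwise.

  In the induction, once an independent vertex weighs 102, the isolated triangle and the target
  force 41 - 7 = 34 and 41 - 2 * 7 = 27. Removing the closed neighbourhood of a vertex of degree
  three then takes nine edges, since 4 * 41 = 164 \<le> 9 * 7 + 102 = 165. The obstacle is a cubic
  vertex on a triangle with only cubic neighbours, where there are eight.\<close>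

definition reach :: "'a set set \<Rightarrow> 'a \<Rightarrow> 'a \<Rightarrow> bool" where
  "reach A = (\<lambda>x y. {x, y} \<in> A)\<^sup>*\<^sup>*"

definition bridge :: "'a set set \<Rightarrow> 'a set \<Rightarrow> bool" where
  "bridge A e \<longleftrightarrow> (\<forall>u v. e = {u, v} \<longrightarrow> \<not> reach (A - {e}) u v)"

lemma reach_sym: "reach A u v \<Longrightarrow> reach A v u"
  unfolding reach_def
  by (rule sympD[OF symp_rtranclp]) (auto simp: symp_def insert_commute)

lemma reach_trans: "reach A u v \<Longrightarrow> reach A v w \<Longrightarrow> reach A u w"
  unfolding reach_def by simp

lemma reach_mono: "A \<subseteq> B \<Longrightarrow> reach A u v \<Longrightarrow> reach B u v"
  unfolding reach_def by (erule rtranclp_mono[THEN predicate2D, rotated]) auto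

lemma reach_edge: "{u, v} \<in> A \<Longrightarrow> reach A u v"
  unfolding reach_def by blast

lemma reach_refl: "reach A u u"
  unfolding reach_def by blast

text \<open>If the new end \<open>z\<close> already occurs on the path, the path is cut back to its
  prefix ending in \<open>z\<close>.\<close>

lemma reach_distinct_path:
  assumes "reach A u v"
  shows "\<exists>xs. xs \<noteq> [] \<and> hd xs = u \<and> last xs = v \<and> distinct xs
    \<and> successively (\<lambda>x y. {x, y} \<in> A) xs"
  using assms unfolding reach_def
proof (induction rule: rtranclp_induct)
  case base
  then show ?case by (intro exI[of _ "[u]"]) simp
next
  case (step y z)
  then obtain xs where xs: "xs \<noteq> []" "hd xs = u" "last xs = y" "distinct xs"
    "successively (\<lambda>x y. {x, y} \<in> A) xs" by blast
  show ?case
  proof (cases "z \<in> set xs")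
    case True
    then obtain ys zs where "xs = ys @ z # zs" by (meson split_list)
    then show ?thesis using xs
      by (intro exI[of _ "ys @ [z]"]) (auto simp: successively_append_iff hd_append split: if_splits)
  next
    case False
    then show ?thesis using xs step
      by (intro exI[of _ "xs @ [z]"]) (auto simp: successively_append_iff)
  qed
qed

lemma bridge_antimono: "bridge A e \<Longrightarrow> B \<subseteq> A \<Longrightarrow> bridge B e"
  unfolding bridge_def using reach_mono[of "B - {e}" "A - {e}"] by blast

text \<open>The first edge of the path cannot recur, because its first vertex does not. Applied to a
  face boundary, this turns few edges into a short cycle.\<close>

lemma successively_distinct_card:
  assumes "distinct xs" "successively (\<lambda>x y. {x, y} \<in> A) xs" "finite A"
  shows "length xs \<le> Suc (card A)"
  using assms
proof (induction xs arbitrary: A rule: induct_list012)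
  case (3 x y zs)
  have "{a, b} \<noteq> {x, y}" if "a \<in> set (y # zs)" "b \<in> set (y # zs)" for a b
    using 3(3) that by (auto simp: doubleton_eq_iff)
  then have "successively (\<lambda>a b. {a, b} \<in> A - {{x, y}}) (y # zs)"
    using 3(4) by (auto intro: successively_mono[where P = "\<lambda>x y. {x, y} \<in> A"])
  then have "length (y # zs) \<le> Suc (card (A - {{x, y}}))"
    using 3(3,5) by (intro 3(2)) auto
  then show ?case
    using 3(4,5) card_Suc_Diff1[of A "{x, y}"] by simp
qed auto

section \<open>Faces of plane drawings\<close>

text \<open>A connected superset that left \<open>C\<close> would cross \<open>frontier C\<close>
  and so meet \<open>K\<close>. This criterion carries a face from one drawing to another.\<close>

lemma component_if_frontier_subset:
  assumes "connected C" "C \<noteq> {}" "C \<inter> K = {}" "frontier C \<subseteq> K"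
  shows "C \<in> components (- K)"
proof -
  have "D = C" if "C \<subseteq> D" "D \<subseteq> - K" "connected D" for D
    using connected_Int_frontier[of D C] that assms by blast
  then show ?thesis
    unfolding in_components_maximal using assms by blast
qed

text \<open>The inverse of the arc would embed an open set of the plane in the line, against
  invariance of dimension. Hence an edge cannot exhaust the face in which it is drawn.\<close>

lemma arc_no_open_subset:
  fixes g :: "real \<Rightarrow> complex"
  assumes "arc g" "open D" "D \<noteq> {}"
  shows "\<not> D \<subseteq> path_image g"
proof
  assume D: "D \<subseteq> path_image g"
  obtain h where h: "homeomorphism {0..1} (path_image g) g h"
    using assms(1) homeomorphism_arc by blast
  have "continuous_on D h" "inj_on h D"
    using h D unfolding homeomorphism_def
    by (meson continuous_on_subset) (metis D h homeomorphism_apply2 inj_on_inverseI subsetD)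
  then have "DIM(complex) \<le> DIM(real)"
    using invariance_of_dimension assms by blast
  then show False by simp
qed

locale plane_graph =
  fixes V :: "'a set" and E :: "'a set set"
    and f :: "'a \<Rightarrow> complex" and \<gamma> :: "'a set \<Rightarrow> real \<Rightarrow> complex"
  assumes finite_V: "finite V"
    and edges: "e \<in> E \<Longrightarrow> \<exists>u v. u \<in> V \<and> v \<in> V \<and> u \<noteq> v \<and> e = {u, v}"
    and inj_f: "inj_on f V"
    and arcs: "e \<in> E \<Longrightarrow> arc (\<gamma> e)"
    and ends: "e \<in> E \<Longrightarrow> {pathstart (\<gamma> e), pathfinish (\<gamma> e)} = f ` e"
    and interior_vertices: "e \<in> E \<Longrightarrow> (path_image (\<gamma> e) - f ` e) \<inter> f ` V = {}"
    and interior_edges: "e \<in> E \<Longrightarrow> e' \<in> E \<Longrightarrow> e' \<noteq> e \<Longrightarrow>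
      (path_image (\<gamma> e) - f ` e) \<inter> path_image (\<gamma> e') = {}"
begin

section \<open>Drawings of edge subsets and their faces\<close>

definition open_arc :: "'a set \<Rightarrow> complex set" where
  "open_arc e = path_image (\<gamma> e) - f ` e"

text \<open>All vertices stay in the drawing whatever \<open>A\<close> is, so deleting an edge frees
  exactly its open arc, and drawings intersect as their edge sets do.\<close>

definition pts :: "'a set set \<Rightarrow> complex set" where
  "pts A = f ` V \<union> (\<Union>e\<in>A. open_arc e)"

definition faces :: "'a set set \<Rightarrow> complex set set" where
  "faces A = components (- pts A)"

text \<open>Lying beside \<open>e\<close> is expressed by deletion, which avoids any local analysis
  of the curve near \<open>e\<close>.\<close>

definition sides :: "'a set set \<Rightarrow> 'a set \<Rightarrow> complex set set" where
  "sides A e = faces A - faces (A - {e})"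

lemma finite_E: "finite E"
proof (rule finite_subset)
  show "E \<subseteq> Pow V" using edges by fastforce
qed (use finite_V in simp)

lemma edge_subset: "e \<in> E \<Longrightarrow> e \<subseteq> V"
  using edges by blast

lemma f_eq_iff: "x \<in> V \<Longrightarrow> y \<in> V \<Longrightarrow> f x = f y \<longleftrightarrow> x = y"
  using inj_f by (meson inj_onD)

lemma ends_subset: "e \<in> E \<Longrightarrow> f ` e \<subseteq> path_image (\<gamma> e)"
  using ends by (metis empty_subsetI insert_subset pathfinish_in_path_image pathstart_in_path_image)

lemma path_image_eq: "e \<in> E \<Longrightarrow> path_image (\<gamma> e) = open_arc e \<union> f ` e"
  using ends_subset unfolding open_arc_def by blast

lemma open_arc_vertices: "e \<in> E \<Longrightarrow> open_arc e \<inter> f ` V = {}"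
  using interior_vertices unfolding open_arc_def by blast

lemma open_arc_disjoint: "e \<in> E \<Longrightarrow> e' \<in> E \<Longrightarrow> e \<noteq> e' \<Longrightarrow> open_arc e \<inter> open_arc e' = {}"
  using interior_edges unfolding open_arc_def by blast

lemma open_arc_pts: "e \<in> E \<Longrightarrow> A \<subseteq> E \<Longrightarrow> e \<notin> A \<Longrightarrow> open_arc e \<inter> pts A = {}"
  using open_arc_vertices open_arc_disjoint unfolding pts_def by blast

lemma connected_open_arc: "e \<in> E \<Longrightarrow> connected (open_arc e)"
  unfolding open_arc_def using connected_simple_path_endless arcs arc_imp_simple_path ends by metis

lemma open_arc_nonempty:
  assumes "e \<in> E"
  shows "open_arc e \<noteq> {}"
proof
  assume "open_arc e = {}"
  then have "finite (path_image (\<gamma> e))"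
    using path_image_eq[OF assms] finite_subset[OF edge_subset[OF assms] finite_V] by simp
  moreover have "infinite (path_image (\<gamma> e))"
    using arcs[OF assms] unfolding arc_def path_image_def
    by (simp add: finite_image_iff infinite_Icc)
  ultimately show False by simp
qed

lemma pts_eq: "A \<subseteq> E \<Longrightarrow> pts A = f ` V \<union> (\<Union>e\<in>A. path_image (\<gamma> e))"
  unfolding pts_def using path_image_eq edge_subset by fast

lemma compact_pts: "A \<subseteq> E \<Longrightarrow> compact (pts A)"
  unfolding pts_eq using finite_V finite_E
  by (intro compact_Un compact_UN)
    (auto intro: finite_subset finite_imp_compact compact_arc_image arcs)

lemma closed_pts: "A \<subseteq> E \<Longrightarrow> closed (pts A)"
  using compact_pts compact_imp_closed by blast

lemma pts_insert: "pts (insert e A) = pts A \<union> open_arc e"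
  unfolding pts_def by blast

lemma pts_mono: "A \<subseteq> B \<Longrightarrow> pts A \<subseteq> pts B"
  unfolding pts_def by blast

lemma pts_Int: "A \<subseteq> E \<Longrightarrow> B \<subseteq> E \<Longrightarrow> pts A \<inter> pts B = pts (A \<inter> B)"
proof
  assume AB: "A \<subseteq> E" "B \<subseteq> E"
  show "pts A \<inter> pts B \<subseteq> pts (A \<inter> B)"
  proof
    fix x assume x: "x \<in> pts A \<inter> pts B"
    show "x \<in> pts (A \<inter> B)"
    proof (cases "x \<in> f ` V")
      case False
      then obtain e e' where "e \<in> A" "e' \<in> B" "x \<in> open_arc e" "x \<in> open_arc e'"
        using x unfolding pts_def by blast
      then have "e = e'" using open_arc_disjoint AB by blast
      with \<open>e \<in> A\<close> \<open>e' \<in> B\<close> \<open>x \<in> open_arc e\<close> show ?thesis unfolding pts_def by blast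
    qed (simp add: pts_def)
  qed
qed (simp add: pts_mono)

lemma frontier_face: "A \<subseteq> E \<Longrightarrow> F \<in> faces A \<Longrightarrow> frontier F \<subseteq> pts A"
  unfolding faces_def using frontier_of_components_closed_complement closed_pts by blast

lemma open_face: "A \<subseteq> E \<Longrightarrow> F \<in> faces A \<Longrightarrow> open F"
  unfolding faces_def using open_components closed_pts by blast

lemma face_nonempty: "F \<in> faces A \<Longrightarrow> F \<noteq> {}"
  unfolding faces_def by (rule in_components_nonempty)

lemma face_pts: "F \<in> faces A \<Longrightarrow> F \<inter> pts A = {}"
  unfolding faces_def using in_components_subset by blast

lemma face_connected: "F \<in> faces A \<Longrightarrow> connected F"
  unfolding faces_def by (rule in_components_connected)

lemma faces_disjoint: "F \<in> faces A \<Longrightarrow> F' \<in> faces A \<Longrightarrow> F \<noteq> F' \<Longrightarrow> F \<inter> F' = {}"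
  unfolding faces_def using components_nonoverlap by blast

lemma face_exists: "x \<notin> pts A \<Longrightarrow> \<exists>F\<in>faces A. x \<in> F"
  unfolding faces_def using Union_components[of "- pts A"] by blast

lemma face_maximal:
  "F \<in> faces A \<Longrightarrow> connected T \<Longrightarrow> T \<inter> pts A = {} \<Longrightarrow> F \<inter> T \<noteq> {} \<Longrightarrow> T \<subseteq> F"
  unfolding faces_def using components_maximal[of F "- pts A" T] by blast

lemma face_superset:
  assumes "connected T" "T \<noteq> {}" "T \<inter> pts A = {}"
  shows "\<exists>F\<in>faces A. T \<subseteq> F"
proof -
  obtain x where "x \<in> T" "x \<notin> pts A" using assms by blast
  then obtain F where F: "F \<in> faces A" "x \<in> F" using face_exists by blast
  then have "T \<subseteq> F" using face_maximal[OF F(1) assms(1,3)] \<open>x \<in> T\<close> by blast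
  then show ?thesis using F by blast
qed

lemma faces_connected_component:
  "F \<in> faces A \<Longrightarrow> x \<in> F \<Longrightarrow> y \<in> F \<longleftrightarrow> connected_component (- pts A) x y"
  unfolding faces_def components_iff
  by (metis connected_component_eq mem_Collect_eq)

lemma faceI:
  "connected F \<Longrightarrow> F \<noteq> {} \<Longrightarrow> F \<inter> pts A = {} \<Longrightarrow> frontier F \<subseteq> pts A \<Longrightarrow> F \<in> faces A"
  unfolding faces_def by (rule component_if_frontier_subset)

text \<open>The frontier of \<open>F\<close> lies in both drawings, hence in the drawing of the
  common edges. Thus edges that are irrelevant to \<open>F\<close> one by one can be deleted
  together.\<close>

lemma faces_Int:
  assumes "A \<subseteq> E" "B \<subseteq> E" "F \<in> faces A" "F \<in> faces B"
  shows "F \<in> faces (A \<inter> B)"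
proof (rule faceI)
  show "frontier F \<subseteq> pts (A \<inter> B)"
    using frontier_face[OF assms(1,3)] frontier_face[OF assms(2,4)] pts_Int[OF assms(1,2)] by blast
  show "F \<inter> pts (A \<inter> B) = {}"
    using face_pts[OF assms(3)] pts_mono[of "A \<inter> B" A] by blast
qed (use assms face_connected face_nonempty in blast)+

lemma faces_Inter:
  assumes "finite S" "S \<subseteq> A" "A \<subseteq> E" "F \<in> faces A" "\<And>h. h \<in> S \<Longrightarrow> F \<in> faces (A - {h})"
  shows "F \<in> faces (A - S)"
  using assms
proof (induction S rule: finite_induct)
  case (insert h S)
  then have "F \<in> faces ((A - S) \<inter> (A - {h}))"
    by (intro faces_Int) auto
  moreover have "(A - S) \<inter> (A - {h}) = A - insert h S" by blast
  ultimately show ?case by simp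
qed simp

section \<open>The effect of deleting one edge\<close>

definition host :: "'a set set \<Rightarrow> 'a set \<Rightarrow> complex set" where
  "host A e = (SOME D. D \<in> faces A \<and> open_arc e \<subseteq> D)"

lemma
  assumes "e \<in> E" "A \<subseteq> E" "e \<notin> A"
  shows host_face: "host A e \<in> faces A" and host_arc: "open_arc e \<subseteq> host A e"
proof -
  have "\<exists>D. D \<in> faces A \<and> open_arc e \<subseteq> D"
    using face_superset[of "open_arc e" A] connected_open_arc open_arc_nonempty open_arc_pts assms
    by blast
  from someI_ex[OF this] show "host A e \<in> faces A" "open_arc e \<subseteq> host A e"
    unfolding host_def by blast+
qed

text \<open>Drawing \<open>e\<close> affects only the face \<open>D\<close> of
  \<open>A - {e}\<close> that contains its open arc: every other face keeps its frontier and avoids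
  the arc. The faces of \<open>A\<close> inside \<open>D\<close> fill \<open>D\<close> up to the
  arc, and there is at least one because an arc contains no open set.\<close>

lemma
  assumes e: "e \<in> A" and A: "A \<subseteq> E"
  shows faces_removed: "faces (A - {e}) - faces A = {host (A - {e}) e}"
    and sides_eq: "sides A e = {C \<in> faces A. C \<subseteq> host (A - {e}) e}"
    and Union_sides: "\<Union>(sides A e) = host (A - {e}) e - open_arc e"
    and sides_nonempty: "sides A e \<noteq> {}"
proof -
  define B where "B = A - {e}"
  define D where "D = host B e"
  have B: "e \<in> E" "B \<subseteq> E" "e \<notin> B" "B \<subseteq> A" using assms by (auto simp: B_def)
  have D: "D \<in> faces B" "open_arc e \<subseteq> D" unfolding D_def using host_face host_arc B by auto
  have ptsA: "pts A = pts B \<union> open_arc e"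
    using pts_insert[of e B] e by (simp add: B_def insert_absorb)
  have stay: "C \<in> faces A" if C: "C \<in> faces B" "C \<noteq> D" for C
  proof (rule faceI)
    show "C \<inter> pts A = {}" using ptsA face_pts[OF C(1)] faces_disjoint[OF C(1) D(1) C(2)] D(2) by blast
    show "frontier C \<subseteq> pts A" using frontier_face[OF B(2) C(1)] ptsA by blast
  qed (use C face_connected face_nonempty in blast)+
  have Dnot: "D \<notin> faces A"
    using face_pts[of D A] ptsA D(2) open_arc_nonempty[OF B(1)] by blast
  show 1: "faces (A - {e}) - faces A = {host (A - {e}) e}"
    using stay Dnot D(1) unfolding B_def D_def by blast
  have sup: "C \<in> faces B \<or> C \<subseteq> D" if C: "C \<in> faces A" for C
  proof -
    obtain C' where C': "C' \<in> faces B" "C \<subseteq> C'"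
      using face_superset[of C B] face_connected[OF C] face_nonempty[OF C] face_pts[OF C] ptsA by blast
    then show ?thesis using stay[of C'] faces_disjoint[OF C, of C'] face_nonempty[OF C] by blast
  qed
  have nsub: "C \<notin> faces B" if "C \<in> faces A" "C \<subseteq> D" for C
    using that Dnot faces_disjoint[of C B D] D face_nonempty by blast
  show 2: "sides A e = {C \<in> faces A. C \<subseteq> host (A - {e}) e}"
    using sup nsub unfolding sides_def B_def D_def by blast
  have "x \<in> \<Union>(sides A e)" if "x \<in> D - open_arc e" for x
  proof -
    have "x \<notin> pts A" using that face_pts[OF D(1)] ptsA by blast
    then obtain C where C: "C \<in> faces A" "x \<in> C" using face_exists by blast
    then have "C \<subseteq> D" using sup[OF C(1)] that faces_disjoint[of C B D] D(1) by blast
    then show ?thesis using C 2 unfolding B_def D_def by blast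
  qed
  then show 3: "\<Union>(sides A e) = host (A - {e}) e - open_arc e"
    using 2 face_pts ptsA unfolding B_def D_def by blast
  have "\<not> D \<subseteq> open_arc e"
    using arc_no_open_subset[OF arcs[OF B(1)], of D] open_face[OF B(2) D(1)] face_nonempty[OF D(1)]
    unfolding open_arc_def by blast
  then show "sides A e \<noteq> {}" using 3 unfolding B_def D_def by blast
qed

text \<open>
  Janiszewski's theorem, applied twice: the arc of a bridge meets the part of the drawing reachable
  from one of its ends in a single point, and their union meets the rest in a single point.
\<close>

lemma bridge_connected:
  assumes e: "e \<in> A" "A \<subseteq> E" "bridge A e"
    and ab: "connected_component (- pts (A - {e})) a b" "a \<notin> open_arc e" "b \<notin> open_arc e"
  shows "connected_component (- pts A) a b"
proof -
  define B where "B = A - {e}"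
  have B: "e \<in> E" "B \<subseteq> E" using e by (auto simp: B_def)
  obtain u v where uv: "u \<in> V" "v \<in> V" "u \<noteq> v" "e = {u, v}" using edges[OF B(1)] by blast
  have nreach: "\<not> reach B u v" using e(3) uv(4) unfolding bridge_def B_def by blast
  define R where "R = {x \<in> V. reach B u x}"
  \<comment> \<open>Every edge of \<open>B\<close> has both ends in \<open>R\<close> or both
    outside, so \<open>K R\<close> and \<open>K (V - R)\<close> split the drawing of
    \<open>B\<close> into two disjoint compact sets.\<close>
  define K where "K W = f ` W \<union> (\<Union>h\<in>{h \<in> B. h \<subseteq> W}. open_arc h)" for W
  define K1 where "K1 = K R"
  define K2 where "K2 = K (V - R)"
  have split: "h \<subseteq> R \<or> h \<subseteq> V - R" if "h \<in> B" for h
  proof -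
    obtain x y where xy: "x \<in> V" "y \<in> V" "h = {x, y}" using edges[of h] \<open>h \<in> B\<close> B by blast
    then have "reach B x y" "reach B y x" using reach_edge[of x y B] reach_sym that by auto
    then have "x \<in> R \<longleftrightarrow> y \<in> R" using xy reach_trans[of B u] unfolding R_def by blast
    then show ?thesis using xy by blast
  qed
  have K12: "K1 \<union> K2 = pts B"
  proof -
    have "B = {h \<in> B. h \<subseteq> R} \<union> {h \<in> B. h \<subseteq> V - R}" using split by blast
    then have "pts B = f ` V \<union> (\<Union>h\<in>{h \<in> B. h \<subseteq> R} \<union> {h \<in> B. h \<subseteq> V - R}. open_arc h)"
      unfolding pts_def by simp
    moreover have "f ` V = f ` R \<union> f ` (V - R)" by (auto simp: R_def)
    ultimately show ?thesis unfolding K1_def K2_def K_def UN_Un by (simp only: Un_ac)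
  qed
  have cl: "compact (K W)" if "W \<subseteq> V" for W
  proof -
    have "path_image (\<gamma> h) = open_arc h \<union> f ` h" if "h \<in> B" for h
      using path_image_eq that B by blast
    then have "K W = f ` W \<union> (\<Union>h\<in>{h \<in> B. h \<subseteq> W}. path_image (\<gamma> h))"
      unfolding K_def by auto
    moreover have "finite W" "finite {h \<in> B. h \<subseteq> W}"
      using that finite_V finite_E B by (auto intro: finite_subset)
    ultimately show ?thesis using B
      by (auto intro!: compact_Un compact_UN compact_arc_image arcs intro: finite_imp_compact)
  qed
  have "K1 \<inter> K2 = {}"
  proof -
    have "f ` R \<inter> f ` (V - R) = {}"
      using f_eq_iff by (auto simp: R_def)
    moreover have "R \<subseteq> V" by (auto simp: R_def)
    moreover have "f x \<notin> open_arc h" if "h \<in> B" "x \<in> V" for h x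
      using that open_arc_vertices B by blast
    moreover have "open_arc h \<inter> open_arc h' = {}"
      if "h \<in> B" "h' \<in> B" "h \<subseteq> R" "h' \<subseteq> V - R" for h h'
    proof -
      have "h \<noteq> h'" using that edges[of h] B by auto
      then show ?thesis using open_arc_disjoint[of h h'] that B by blast
    qed
    ultimately show ?thesis
      unfolding K1_def K2_def K_def by (auto simp: disjoint_iff subset_iff)
  qed
  have uR: "u \<in> R" "v \<in> V - R" using uv nreach by (auto simp: R_def reach_refl)
  let ?S = "path_image (\<gamma> e)"
  have S: "?S = open_arc e \<union> {f u, f v}" using path_image_eq[OF B(1)] uv by simp
  have e_pts: "open_arc e \<inter> pts B = {}" using open_arc_pts B by (simp add: B_def)
  have uvK: "f u \<in> K1" "f v \<in> K2" using uR unfolding K1_def K2_def K_def by auto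
  have S1: "?S \<inter> K1 = {f u}" and S2: "(?S \<union> K1) \<inter> K2 = {f v}"
    using S e_pts K12 \<open>K1 \<inter> K2 = {}\<close> uvK by auto
  have ab': "a \<notin> pts B" "b \<notin> pts B"
    using ab(1) connected_component_in unfolding B_def by fastforce+
  have "a \<notin> ?S" "b \<notin> ?S" using ab ab' S uv unfolding pts_def by auto
  then have "connected_component (- ?S) a b"
    using connected_arc_complement[OF arcs[OF B(1)]] by (simp add: connected_iff_connected_component)
  moreover have "connected_component (- K1) a b" "connected_component (- K2) a b"
    using ab(1) K12 connected_component_of_subset[of "- pts B"] unfolding B_def[symmetric] by blast+
  moreover have "compact ?S" using arcs[OF B(1)] by (simp add: compact_arc_image)
  ultimately have "connected_component (- (?S \<union> K1 \<union> K2)) a b"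
    by (intro Janiszewski) (use S1 S2 cl[of R] cl[of "V - R"] compact_imp_closed K1_def K2_def R_def in auto)
  moreover have "?S \<union> K1 \<union> K2 = pts A"
  proof -
    have "pts A = pts B \<union> open_arc e" using pts_insert[of e B] e by (simp add: B_def insert_absorb)
    then show ?thesis using K12 S uv unfolding pts_def by auto
  qed
  ultimately show ?thesis by simp
qed

text \<open>Points of two faces beside \<open>e\<close> lie in the same host face, off the arc of
  \<open>e\<close>. Since drawing a bridge does not separate them, the two faces coincide.\<close>

lemma card_sides_bridge:
  assumes "e \<in> A" "A \<subseteq> E" "bridge A e"
  shows "card (sides A e) = 1"
proof -
  have "C = C'" if CC': "C \<in> sides A e" "C' \<in> sides A e" for C C'
  proof -
    have C: "C \<in> faces A" "C' \<in> faces A" using CC' by (auto simp: sides_def)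
    obtain a b where ab: "a \<in> C" "b \<in> C'" using C face_nonempty by blast
    have "a \<in> host (A - {e}) e - open_arc e" "b \<in> host (A - {e}) e - open_arc e"
      using ab CC' Union_sides[OF assms(1,2)] by blast+
    moreover have "host (A - {e}) e \<in> faces (A - {e})"
      using host_face assms by blast
    ultimately have "connected_component (- pts A) a b"
      using bridge_connected[OF assms] faces_connected_component by blast
    then show ?thesis using ab C faces_connected_component faces_disjoint by blast
  qed
  then have "\<exists>C. sides A e = {C}" using sides_nonempty[OF assms(1,2)] by blast
  then show ?thesis by auto
qed

lemma reach_path:
  assumes "B \<subseteq> E" "reach B u v" "u \<in> V"
  shows "path_component (pts B) (f u) (f v)"
  using assms(2)[unfolded reach_def]
proof (induction rule: rtranclp_induct)
  case base
  then show ?case using assms by (auto simp: pts_def intro: path_component_refl)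
next
  case (step x y)
  have xy: "{x, y} \<in> E" using step assms by auto
  have "path_connected (path_image (\<gamma> {x, y}))"
    using arcs[OF xy] by (simp add: arc_imp_path path_connected_path_image)
  then have "path_component (path_image (\<gamma> {x, y})) (f x) (f y)"
    using ends_subset[OF xy] by (simp add: path_connected_component)
  then have "path_component (pts B) (f x) (f y)"
    by (rule path_component_of_subset[rotated]) (use pts_eq assms step in auto)
  then show ?case using step path_component_trans by blast
qed

text \<open>
  A non-bridge lies on a Jordan curve \<open>c\<close> that meets the rest of the drawing in an arc. By
  Janiszewski's theorem two points of the host face are separated by the drawing only if they are
  separated by \<open>c\<close>; both sides of \<open>c\<close> occur because both have \<open>c\<close> as frontier.
\<close>

lemma nonbridge_sides:
  assumes e: "e \<in> A" "A \<subseteq> E" "\<not> bridge A e"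
  shows "card (sides A e) = 2"
proof -
  define B where "B = A - {e}"
  define D where "D = host B e"
  have B: "e \<in> E" "B \<subseteq> E" "e \<notin> B" using e by (auto simp: B_def)
  obtain u v where uv: "e = {u, v}" "reach B u v" using e(3) unfolding bridge_def B_def by blast
  have uvV: "u \<in> V" "v \<in> V" using edge_subset[OF B(1)] uv by auto
  have "u \<noteq> v" using edges[OF B(1)] uv by auto
  then have fuv: "f u \<noteq> f v" using f_eq_iff uvV by blast
  have D: "D \<in> faces B" "open_arc e \<subseteq> D" unfolding D_def using host_face host_arc B by auto
  have ptsA: "pts A = pts B \<union> open_arc e"
    using pts_insert[of e B] e by (simp add: B_def insert_absorb)
  have "\<exists>x y. x \<noteq> y \<and> pathstart (\<gamma> e) = x \<and> pathfinish (\<gamma> e) = y \<and> path_component (pts B) y x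
    \<and> {x, y} = f ` e"
  proof -
    have "path_component (pts B) (f u) (f v)" "path_component (pts B) (f v) (f u)"
      using reach_path[OF B(2) uv(2) uvV(1)] reach_path[OF B(2) reach_sym[OF uv(2)] uvV(2)] by simp_all
    then show ?thesis using ends[OF B(1)] fuv unfolding uv(1)
      by (smt (verit, ccfv_threshold) doubleton_eq_iff image_empty image_insert)
  qed
  then obtain x y where xy: "x \<noteq> y" "pathstart (\<gamma> e) = x" "pathfinish (\<gamma> e) = y"
      "path_component (pts B) y x" "{x, y} = f ` e" by blast
  obtain p where p: "path p" "path_image p \<subseteq> pts B" "pathstart p = y" "pathfinish p = x"
    using xy(4) unfolding path_component_def by blast
  \<comment> \<open>The path \<open>p\<close> may revisit points; an arc inside its image is needed
    for \<open>c\<close> to be a simple closed curve.\<close>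
  obtain g where g: "arc g" "path_image g \<subseteq> path_image p" "pathstart g = y" "pathfinish g = x"
    using path_connected_path_image[OF p(1)] xy(1) p unfolding path_connected_arcwise
    by (metis pathfinish_in_path_image pathstart_in_path_image)
  have gB: "path_image g \<subseteq> pts B" using g p by blast
  define c where "c = \<gamma> e +++ g"
  have e_img: "path_image (\<gamma> e) = open_arc e \<union> {x, y}" using path_image_eq[OF B(1)] xy by simp
  have e_pts: "open_arc e \<inter> pts B = {}" using open_arc_pts B by simp
  have c_img: "path_image c = path_image (\<gamma> e) \<union> path_image g"
    unfolding c_def by (rule path_image_join) (simp add: xy g)
  have xyg: "x \<in> path_image g" "y \<in> path_image g"
    using g pathstart_in_path_image pathfinish_in_path_image by metis+
  have "simple_path c"
    unfolding c_def
    by (rule simple_path_join_loop) (use arcs[OF B(1)] g xy e_img e_pts gB in auto)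
  moreover have "pathfinish c = pathstart c" unfolding c_def by (simp add: g xy)
  ultimately obtain inner outer where io: "open inner" "open outer" "inner \<inter> outer = {}"
    "connected inner" "connected outer"
    "inner \<union> outer = - path_image c" "frontier inner = path_image c" "frontier outer = path_image c"
    using Jordan_curve[of c] by metis
  have cA: "path_image c \<union> pts B = pts A"
    using c_img e_img gB ptsA xyg by blast
  have join: "connected_component (- pts A) a b"
    if ab: "a \<in> D" "b \<in> D" "a \<in> I" "b \<in> I" and I: "connected I" "I \<inter> path_image c = {}" for a b I
  proof -
    have "connected_component (- path_image c) a b"
      unfolding connected_component_def using ab I by blast
    moreover have "connected_component (- pts B) a b"
      using faces_connected_component D(1) ab by blast
    moreover have "path_image c \<inter> pts B = path_image g"
      using c_img e_img gB e_pts xyg by blast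
    ultimately have "connected_component (- (path_image c \<union> pts B)) a b"
      using Janiszewski[of "path_image c" "pts B"] compact_simple_path_image[OF \<open>simple_path c\<close>]
        closed_pts[OF B(2)] connected_arc_image[OF g(1)] by simp
    then show ?thesis using cA by simp
  qed
  obtain z where z: "z \<in> open_arc e" using open_arc_nonempty[OF B(1)] by blast
  have openD: "open D" using open_face B D by blast
  have zc: "z \<in> path_image c" "z \<in> D" using z D e_img c_img by auto
  have "z \<in> closure inner" "z \<in> closure outer"
    using zc io(7,8) unfolding frontier_def by blast+
  then have "inner \<inter> D \<noteq> {}" "outer \<inter> D \<noteq> {}"
    using open_Int_closure_eq_empty[OF openD] zc by blast+
  then obtain a b where ab: "a \<in> inner" "a \<in> D" "b \<in> outer" "b \<in> D" by blast
  have inn: "inner \<inter> path_image c = {}" "outer \<inter> path_image c = {}" using io by blast+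
  have Dpts: "D \<inter> pts B = {}" using face_pts[OF D(1)] .
  have ab_pts: "a \<notin> pts A" "b \<notin> pts A" using ab inn Dpts ptsA c_img e_img by blast+
  obtain Fa Fb where F: "Fa \<in> faces A" "a \<in> Fa" "Fb \<in> faces A" "b \<in> Fb"
    using face_exists ab_pts by metis
  have one_side: "C \<subseteq> inner \<or> C \<subseteq> outer" if "C \<in> faces A" for C
  proof -
    have "C \<inter> path_image c = {}" using face_pts[OF that] cA by blast
    then have "C \<subseteq> inner \<union> outer" using io by blast
    then show ?thesis
      using connectedD[OF face_connected[OF that] io(1,2)] io(3) by blast
  qed
  have "Fa \<noteq> Fb" using one_side[OF F(1)] F ab io(3) by blast
  have U: "\<Union>(sides A e) = D - open_arc e" and S: "sides A e = {C \<in> faces A. C \<subseteq> D}"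
    using Union_sides[OF e(1,2)] sides_eq[OF e(1,2)] unfolding D_def B_def by auto
  have "a \<in> D - open_arc e" "b \<in> D - open_arc e" using ab inn c_img e_img by blast+
  then have "Fa \<in> sides A e" "Fb \<in> sides A e"
    using U F faces_disjoint[of _ A] unfolding sides_def by blast+
  moreover have "C = Fa \<or> C = Fb" if C: "C \<in> sides A e" for C
  proof -
    obtain q where q: "q \<in> C" using C face_nonempty unfolding sides_def by blast
    have qD: "q \<in> D" "C \<in> faces A" using C S q by auto
    consider "q \<in> inner" | "q \<in> outer" using one_side[OF qD(2)] q by blast
    then show ?thesis
    proof cases
      case 1
      then have "connected_component (- pts A) a q"
        using join[OF ab(2) qD(1) ab(1)] inn io(4,5) by blast
      then have "q \<in> Fa" using faces_connected_component F by blast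
      then show ?thesis using faces_disjoint[OF qD(2) F(1)] q by blast
    next
      case 2
      then have "connected_component (- pts A) b q"
        using join[OF ab(4) qD(1) ab(3)] inn io(4,5) by blast
      then have "q \<in> Fb" using faces_connected_component F by blast
      then show ?thesis using faces_disjoint[OF qD(2) F(3)] q by blast
    qed
  qed
  ultimately have "sides A e = {Fa, Fb}" by blast
  then show ?thesis using \<open>Fa \<noteq> Fb\<close> by simp
qed

end

section \<open>Euler's inequality and face boundaries\<close>

context plane_graph
begin

text \<open>The path closed up by \<open>e\<close> is a cycle of length \<open>length xs\<close>. It
  has at least three vertices since the direct step is \<open>e\<close> itself, and
  \<open>length xs - 1\<close> edges taken from \<open>A - {e}\<close> give the upper bound.\<close>

lemma cycle_path:
  assumes "e \<in> A" "A \<subseteq> E" "\<not> bridge A e" "e = {u, v}"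
  obtains xs where "distinct xs" "hd xs = u" "last xs = v" "3 \<le> length xs" "length xs \<le> card A"
    "successively (\<lambda>x y. {x, y} \<in> A - {e}) xs"
proof -
  have "reach (A - {e}) u v"
    using assms(3,4) reach_sym[of "A - {e}"] unfolding bridge_def by (auto simp: doubleton_eq_iff)
  from reach_distinct_path[OF this]
  obtain xs where xs: "xs \<noteq> []" "hd xs = u" "last xs = v" "distinct xs"
      "successively (\<lambda>x y. {x, y} \<in> A - {e}) xs"
    by blast
  have uv: "u \<noteq> v" using edges[of e] assms by auto
  obtain x y zs where xyz: "xs = x # y # zs"
    using xs(1-3) uv by (metis last.simps list.exhaust list.sel(1))
  have "zs \<noteq> []" using xs assms(4) uv xyz by auto
  moreover have "finite A" using finite_E assms finite_subset by blast
  then have "length xs \<le> card A"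
    using successively_distinct_card[OF xs(4,5)] assms(1) by (simp add: card_gt_0_iff)
      (metis Suc_pred card_gt_0_iff empty_iff)
  ultimately show ?thesis using xs xyz that[of xs] by (cases zs) auto
qed

section \<open>Counting faces and components\<close>

lemma faces_empty: "faces {} = {- pts {}}"
proof -
  have "countable (pts {})" using finite_V by (simp add: pts_def countable_finite)
  then have "connected (- pts {})"
    using path_connected_complement_countable[of "pts {}"] path_connected_imp_connected by simp
  moreover have "finite (pts {})" using finite_V by (simp add: pts_def)
  then have "- pts {} \<noteq> {}" using infinite_UNIV_char_0 by (metis Compl_eq_Diff_UNIV Diff_eq_empty_iff finite_subset)
  ultimately show ?thesis unfolding faces_def components_eq_sing_iff by simp
qed

text \<open>Passing from \<open>A - {e}\<close> to \<open>A\<close> replaces exactly one face, the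
  host of \<open>e\<close>, by the sides of \<open>e\<close>.\<close>

lemma finite_faces: "A \<subseteq> E \<Longrightarrow> finite (faces A)"
  and card_faces_bridge: "e \<in> A \<Longrightarrow> A \<subseteq> E \<Longrightarrow> bridge A e \<Longrightarrow>
    card (faces A) = card (faces (A - {e}))"
  and card_faces_nonbridge: "e \<in> A \<Longrightarrow> A \<subseteq> E \<Longrightarrow> \<not> bridge A e \<Longrightarrow>
    card (faces A) = card (faces (A - {e})) + 1"
proof -
  have removed: "card (faces (A - {e}) - faces A) = 1" "finite (faces (A - {e}) - faces A)"
    if "e \<in> A" "A \<subseteq> E" for A e
    using faces_removed[OF that] by simp_all
  have fin_sides: "finite (sides A e)" if "e \<in> A" "A \<subseteq> E" for A e
    using card_sides_bridge[OF that] nonbridge_sides[OF that] by (cases "bridge A e") (auto intro: card_ge_0_finite)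
  show fin: "finite (faces A)" if "A \<subseteq> E" for A
    using finite_subset[OF that finite_E] that
  proof (induction A rule: finite_induct)
    case empty
    show ?case by (simp add: faces_empty)
  next
    case (insert e A)
    have "faces (insert e A) \<subseteq> faces A \<union> sides (insert e A) e"
      using insert unfolding sides_def by auto
    then show ?case using insert fin_sides[of e "insert e A"] finite_subset by (metis finite_UnI insertI1 insert_subset)
  qed
  have diff: "card (faces A) + 1 = card (faces (A - {e})) + card (sides A e)"
    if "e \<in> A" "A \<subseteq> E" for A e
  proof -
    let ?B = "A - {e}"
    have f: "finite (faces A)" "finite (faces ?B)" using fin that by blast+
    have "card (faces A) = card (faces A \<inter> faces ?B) + card (sides A e)"
      unfolding sides_def using card_Int_Diff[OF f(1)] by simp
    moreover have "card (faces ?B) = card (faces A \<inter> faces ?B) + 1"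
      using card_Int_Diff[OF f(2), of "faces A"] removed[OF that] by (simp add: Int_commute)
    ultimately show ?thesis by simp
  qed
  show "card (faces A) = card (faces (A - {e}))" if "e \<in> A" "A \<subseteq> E" "bridge A e"
    using diff[OF that(1,2)] card_sides_bridge[OF that] by simp
  show "card (faces A) = card (faces (A - {e})) + 1" if "e \<in> A" "A \<subseteq> E" "\<not> bridge A e"
    using diff[OF that(1,2)] nonbridge_sides[OF that] by simp
qed

text \<open>A forest has one face: bridges stay bridges in smaller edge sets, so deleting them one
  by one never changes the number of faces.\<close>

lemma nonbridge_exists:
  assumes "A \<subseteq> E" "card (faces A) > 1"
  shows "\<exists>e\<in>A. \<not> bridge A e"
  using finite_subset[OF assms(1) finite_E] assms
proof (induction A rule: finite_induct)
  case empty
  then show ?case by (simp add: faces_empty)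
next
  case (insert e A)
  show ?case
  proof (rule ccontr)
    assume b: "\<not> ?thesis"
    then have "card (faces (insert e A)) = card (faces A)"
      using card_faces_bridge[of e "insert e A"] insert by simp
    then obtain h where "h \<in> A" "\<not> bridge A h" using insert by auto
    moreover have "bridge A h" using b \<open>h \<in> A\<close> bridge_antimono[of "insert e A" h A] by auto
    ultimately show False by blast
  qed
qed

definition classes :: "'a set set \<Rightarrow> 'a set set" where
  "classes A = (\<lambda>x. Collect (reach A x)) ` V"

text \<open>\<open>g\<close> sends each component of \<open>A - {e}\<close> to the component of
  \<open>A\<close> containing it. It is onto, but identifies the components of \<open>u\<close> and
  \<open>v\<close>.\<close>

lemma classes_bridge:
  assumes "e \<in> A" "A \<subseteq> E" "bridge A e"
  shows "card (classes A) < card (classes (A - {e}))"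
proof -
  obtain u v where uv: "u \<in> V" "v \<in> V" "u \<noteq> v" "e = {u, v}" using edges assms by blast
  define g where "g S = (\<Union>x\<in>S. Collect (reach A x))" for S
  have g: "g (Collect (reach (A - {e}) x)) = Collect (reach A x)" for x
  proof
    show "g (Collect (reach (A - {e}) x)) \<subseteq> Collect (reach A x)"
      unfolding g_def using reach_mono[of "A - {e}" A x] reach_trans[of A x] by auto
    show "Collect (reach A x) \<subseteq> g (Collect (reach (A - {e}) x))"
      unfolding g_def using reach_refl[of "A - {e}" x] by auto
  qed
  have fin: "finite (classes (A - {e}))" unfolding classes_def using finite_V by simp
  have img: "classes A = g ` classes (A - {e})"
    unfolding classes_def image_image g ..
  have "Collect (reach (A - {e}) u) \<noteq> Collect (reach (A - {e}) v)"
    using assms(3) uv(4) reach_refl[of "A - {e}" v] unfolding bridge_def by auto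
  moreover have "reach A u v" by (rule reach_edge) (use assms(1) uv(4) in blast)
  then have "Collect (reach A u) = Collect (reach A v)"
    by (blast intro: reach_trans reach_sym[of A u v])
  ultimately have "\<not> inj_on g (classes (A - {e}))"
    unfolding inj_on_def classes_def using g uv by (metis imageI)
  then show ?thesis
    using img fin card_image_le[OF fin, of g] eq_card_imp_inj_on[OF fin, of g] by fastforce
qed

lemma classes_nonbridge:
  assumes "e \<in> A" "A \<subseteq> E" "\<not> bridge A e"
  shows "classes A = classes (A - {e})"
proof -
  obtain u v where uv: "e = {u, v}" "reach (A - {e}) u v" using assms(3) unfolding bridge_def by blast
  have "reach (A - {e}) x y" if "reach A x y" for x y
    using that unfolding reach_def[of A]
  proof (induction rule: rtranclp_induct)
    case base
    then show ?case by (rule reach_refl)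
  next
    case (step y z)
    have "reach (A - {e}) y z"
    proof (cases "{y, z} = e")
      case True
      then show ?thesis using uv reach_sym[OF uv(2)] by (auto simp: doubleton_eq_iff)
    next
      case False
      then have "{y, z} \<in> A - {e}" using step by simp
      then show ?thesis by (rule reach_edge)
    qed
    with step.IH show ?case by (rule reach_trans)
  qed
  then have "reach A = reach (A - {e})"
    using reach_mono[of "A - {e}" A] by blast
  then show ?thesis unfolding classes_def by simp
qed

text \<open>A bridge lowers the number of components and keeps that of the faces; any other edge
  keeps the components and adds a face. This direction of Euler's formula is the one that bounds the
  edges from above.\<close>

lemma euler:
  assumes "A \<subseteq> E"
  shows "card A + card (classes A) + 1 \<le> card (faces A) + card V"
  using finite_subset[OF assms finite_E] assms
proof (induction A rule: finite_induct)
  case empty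
  have "card (classes {}) \<le> card V"
    unfolding classes_def using finite_V by (rule card_image_le)
  then show ?case by (simp add: faces_empty)
next
  case (insert e A)
  then have IH: "card A + card (classes A) + 1 \<le> card (faces A) + card V" by simp
  have e: "e \<in> insert e A" "insert e A \<subseteq> E" "insert e A - {e} = A" using insert by auto
  show ?case
  proof (cases "bridge (insert e A) e")
    case True
    then show ?thesis
      using IH insert classes_bridge[OF e(1,2)] card_faces_bridge[OF e(1,2)] e(3) by simp
  next
    case False
    then show ?thesis
      using IH insert classes_nonbridge[OF e(1,2)] card_faces_nonbridge[OF e(1,2)] e(3) by simp
  qed
qed

section \<open>Edges on the boundary of a face\<close>

text \<open>As a set of edges it counts a bridge once, although a facial walk would traverse it
  twice. It need be neither connected nor a cycle.\<close>

definition boundary :: "'a set set \<Rightarrow> complex set \<Rightarrow> 'a set set" where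
  "boundary A F = {e \<in> A. F \<notin> faces (A - {e})}"

lemma sides_boundary: "F \<in> faces A \<Longrightarrow> e \<in> A \<Longrightarrow> F \<in> sides A e \<longleftrightarrow> e \<in> boundary A F"
  unfolding sides_def boundary_def by blast

text \<open>Each edge outside the boundary can be deleted without harm to \<open>F\<close>, hence by
  \<open>faces_Inter\<close> all of them at once.\<close>

lemma face_of_boundary:
  assumes "A \<subseteq> E" "F \<in> faces A"
  shows "F \<in> faces (boundary A F)"
proof -
  have "finite A" using assms(1) finite_E by (rule finite_subset)
  have "F \<in> faces (A - {h \<in> A. F \<in> faces (A - {h})})"
    by (rule faces_Inter[OF _ _ assms]) (use \<open>finite A\<close> in auto)
  moreover have "A - {h \<in> A. F \<in> faces (A - {h})} = boundary A F"
    unfolding boundary_def by blast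
  ultimately show ?thesis by simp
qed

text \<open>Another face \<open>F'\<close> of \<open>A\<close> lies in some face of the boundary
  drawing. If \<open>F\<close> were the only one there, \<open>F'\<close> would lie inside
  \<open>F\<close>. With \<open>nonbridge_exists\<close>, the boundary thus contains a
  cycle.\<close>

lemma faces_boundary_gt_1:
  assumes "A \<subseteq> E" "F \<in> faces A" "card (faces A) > 1"
  shows "card (faces (boundary A F)) > 1"
proof (rule ccontr)
  let ?B = "boundary A F"
  assume n: "\<not> ?thesis"
  have BA: "?B \<subseteq> A" "?B \<subseteq> E" using assms(1) unfolding boundary_def by auto
  have "\<exists>F'. F' \<in> faces A \<and> F' \<noteq> F"
  proof (rule ccontr)
    assume "\<not> ?thesis"
    then have "card (faces A) \<le> card {F}" by (intro card_mono) auto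
    then show False using assms(3) by simp
  qed
  then obtain F' where F': "F' \<in> faces A" "F' \<noteq> F" by blast
  have Fin: "F \<in> faces ?B" using face_of_boundary assms by blast
  have "F' \<inter> pts ?B = {}" using face_pts[OF F'(1)] pts_mono[OF BA(1)] by blast
  then obtain D where D: "D \<in> faces ?B" "F' \<subseteq> D"
    using face_superset face_connected[OF F'(1)] face_nonempty[OF F'(1)] by blast
  have "D = F"
  proof (rule ccontr)
    assume "D \<noteq> F"
    then have "card {D, F} \<le> card (faces ?B)" using D Fin finite_faces[OF BA(2)] by (intro card_mono) auto
    then show False using n \<open>D \<noteq> F\<close> by simp
  qed
  then show False using D faces_disjoint[OF F'(1) assms(2) F'(2)] face_nonempty[OF F'(1)] by blast
qed

text \<open>Points of \<open>F\<close> and of the opposite face \<open>F'\<close> can be joined once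
  \<open>e\<close> is deleted. If \<open>e\<close> were a bridge of the boundary, they could be
  joined in the complement of the boundary drawing, where \<open>F\<close> is still a face, and
  \<open>F'\<close> would meet \<open>F\<close>.\<close>

lemma nonbridge_boundary:
  assumes A: "A \<subseteq> E" and F: "F \<in> sides A e" "e \<in> A" and e: "\<not> bridge A e"
  shows "\<not> bridge (boundary A F) e"
proof
  let ?B = "boundary A F"
  assume b: "bridge ?B e"
  have eE: "e \<in> E" using F A by blast
  have FA: "F \<in> faces A" using F unfolding sides_def by blast
  have BA: "?B \<subseteq> A" "?B \<subseteq> E" "e \<in> ?B"
    using A F sides_boundary[OF FA] unfolding boundary_def by auto
  have "card (sides A e) = 2" using nonbridge_sides F A e by blast
  then obtain F' where F': "F' \<in> sides A e" "F' \<noteq> F"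
    by (metis card_2_iff insert_iff)
  have F'A: "F' \<in> faces A" using F' unfolding sides_def by blast
  obtain a b where ab: "a \<in> F" "b \<in> F'" using face_nonempty FA F'A by blast
  have "a \<in> host (A - {e}) e - open_arc e" "b \<in> host (A - {e}) e - open_arc e"
    using ab Union_sides[OF F(2) A] F F' by blast+
  moreover have "host (A - {e}) e \<in> faces (A - {e})" using host_face eE A by blast
  ultimately have c: "connected_component (- pts (A - {e})) a b" "a \<notin> open_arc e" "b \<notin> open_arc e"
    using faces_connected_component by blast+
  have "pts (?B - {e}) \<subseteq> pts (A - {e})" using BA by (intro pts_mono) blast
  then have "connected_component (- pts (?B - {e})) a b"
    using connected_component_of_subset[OF c(1)] by blast
  then have "connected_component (- pts ?B) a b"
    using bridge_connected[OF BA(3,2) b _ c(2,3)] by blast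
  then have "b \<in> F" using faces_connected_component[OF face_of_boundary[OF A FA] ab(1)] by blast
  then show False using ab faces_disjoint[OF FA F'A] F'(2) by blast
qed

end

section \<open>Triangles away from short cycles\<close>

text \<open>In \<open>triangle_5_cycle\<close> the vertex \<open>c\<close> may coincide with
  \<open>x\<close>, \<open>y\<close> or \<open>z\<close>: the 5-cycle may pass through the third
  vertex of the triangle, as happens in \<open>short_path\<close>.\<close>

locale sparse_plane_graph = plane_graph +
  assumes diamond: "{a, b} \<in> E \<Longrightarrow> {b, c} \<in> E \<Longrightarrow> {a, c} \<in> E \<Longrightarrow> {b, d} \<in> E \<Longrightarrow> {a, d} \<in> E \<Longrightarrow> c = d"
    and triangle_5_cycle: "{a, b} \<in> E \<Longrightarrow> {b, c} \<in> E \<Longrightarrow> {a, c} \<in> E \<Longrightarrow> distinct [a, b, x, y, z] \<Longrightarrow>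
      {b, x} \<in> E \<Longrightarrow> {x, y} \<in> E \<Longrightarrow> {y, z} \<in> E \<Longrightarrow> {a, z} \<in> E \<Longrightarrow> False"
begin

lemma short_path:
  assumes T: "{u, v} \<in> E" "{u, c} \<in> E" "{v, c} \<in> E"
    and xs: "distinct xs" "hd xs = u" "last xs = v" "3 \<le> length xs" "length xs \<le> 5"
      "successively (\<lambda>x y. {x, y} \<in> E) xs"
  shows "xs = [u, c, v]"
proof -
  have neq: "u \<noteq> v" "u \<noteq> c" "v \<noteq> c" using T edges by fastforce+
  consider w where "xs = [u, w, v]" | x y where "xs = [u, x, y, v]" | x y z where "xs = [u, x, y, z, v]"
  proof -
    obtain a b d xs' where "xs = a # b # d # xs'" "length xs' \<le> 2"
      using xs(4,5) by (auto simp: numeral_3_eq_3 Suc_le_length_iff)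
    then show thesis using that xs(2,3)
      by (cases xs'; cases "tl xs'"; cases "tl (tl xs')") auto
  qed
  then show ?thesis
  proof cases
    case 1
    then show ?thesis using diamond[of u v c w] xs T by (simp add: insert_commute)
  next
    case 2
    then have e: "{u, x} \<in> E" "{x, y} \<in> E" "{y, v} \<in> E" "distinct [u, x, y, v]" using xs by simp_all
    \<comment> \<open>If \<open>c\<close> lay on the path, \<open>{c, v}\<close> or
      \<open>{u, c}\<close> would be in two triangles. Otherwise replacing \<open>{u, v}\<close> by
      the detour through \<open>c\<close> gives the 5-cycle \<open>u\<close>, \<open>c\<close>,
      \<open>v\<close>, \<open>y\<close>, \<open>x\<close>.\<close>
    have "c \<noteq> x" using diamond[of x v u y] e T by (auto simp: insert_commute)
    moreover have "c \<noteq> y" using diamond[of u y v x] e T by (auto simp: insert_commute)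
    ultimately show ?thesis
      using triangle_5_cycle[of u c v v y x] e T neq by (auto simp: insert_commute)
  next
    case 3
    then have "{u, x} \<in> E" "{x, y} \<in> E" "{y, z} \<in> E" "{z, v} \<in> E" "distinct [u, x, y, z, v]"
      using xs by simp_all
    then show ?thesis using triangle_5_cycle[of v u c x y z] T by (auto simp: insert_commute)
  qed
qed

text \<open>A non-bridge among at most five edges lies on a cycle of length at most five, which for
  a triangle edge can only be its triangle.\<close>

lemma boundary_path:
  assumes "e \<in> E" "e = {u, v}" "{u, c} \<in> E" "{v, c} \<in> E" "e \<in> A" "A \<subseteq> E" "\<not> bridge A e" "card A \<le> 5"
  shows "{u, c} \<in> A - {e}" "{v, c} \<in> A - {e}"
proof -
  obtain xs where xs: "distinct xs" "hd xs = u" "last xs = v" "3 \<le> length xs" "length xs \<le> card A"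
    "successively (\<lambda>x y. {x, y} \<in> A - {e}) xs"
    using cycle_path[OF assms(5,6,7,2)] by blast
  have "successively (\<lambda>x y. {x, y} \<in> E) xs"
    using assms(6) by (intro successively_mono[OF xs(6)]) auto
  then have "xs = [u, c, v]" using short_path[OF _ assms(3,4) xs(1-4)] xs(5) assms by simp
  then show "{u, c} \<in> A - {e}" "{v, c} \<in> A - {e}" using xs(6) by (auto simp: insert_commute)
qed

lemma card_faces_Diff:
  assumes "A \<subseteq> E" "e \<in> A \<Longrightarrow> bridge A e"
  shows "card (faces (A - {e})) = card (faces A)"
  using card_faces_bridge assms by (cases "e \<in> A") auto

lemma boundary_card_ge_3:
  assumes "F \<in> faces E" "card (faces E) > 1"
  shows "card (boundary E F) \<ge> 3"
proof -
  have B: "boundary E F \<subseteq> E" by (auto simp: boundary_def)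
  obtain h where h: "h \<in> boundary E F" "\<not> bridge (boundary E F) h"
    using nonbridge_exists[OF B] faces_boundary_gt_1 assms by blast
  then obtain u v where "h = {u, v}" using B edges by blast
  from cycle_path[OF h(1) B h(2) this] show ?thesis by (metis le_trans)
qed

text \<open>
  The discharging fails only if the triangle bounding \<open>F\<close> also belongs to the boundary of \<open>F'\<close>.
  After deleting \<open>e\<close>, the merged face has no cycle on its boundary, so it is the only face.
\<close>

lemma triangle_side:
  assumes e: "e \<in> E" "\<not> bridge E e" and F: "F \<in> sides E e" "F' \<in> sides E e" "F \<noteq> F'"
    and card: "card (boundary E F) \<le> 3" "card (boundary E F') \<le> 5"
  shows "card (faces E) \<le> 2"
proof (rule ccontr)
  assume many: "\<not> ?thesis"
  obtain u v where uv: "e = {u, v}" using edges e by blast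
  let ?H = "boundary E F" and ?H' = "boundary E F'"
  have faces: "F \<in> faces E" "F' \<in> faces E" using F by (auto simp: sides_def)
  have HE: "?H \<subseteq> E" "?H' \<subseteq> E" by (auto simp: boundary_def)
  have eH: "e \<in> ?H" "e \<in> ?H'" using F e sides_boundary faces by blast+
  have nb: "\<not> bridge ?H e" "\<not> bridge ?H' e" using nonbridge_boundary[OF order_refl] F e by blast+
  have fin: "finite ?H" "finite ?H'" using HE finite_E finite_subset by blast+
  obtain xs where xs: "distinct xs" "hd xs = u" "last xs = v" "3 \<le> length xs" "length xs \<le> card ?H"
    "successively (\<lambda>x y. {x, y} \<in> ?H - {e}) xs"
    using cycle_path[OF eH(1) HE(1) nb(1) uv] by blast
  then have "length xs = 3" using card by simp
  then obtain c where "xs = [u, c, v]" using xs(2,3)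
    by (auto simp: numeral_3_eq_3 length_Suc_conv)
  then have c: "{u, c} \<in> ?H" "{v, c} \<in> ?H" "u \<noteq> v" "u \<noteq> c" "v \<noteq> c"
    using xs by (auto simp: insert_commute)
  then have cE: "{u, c} \<in> E" "{v, c} \<in> E" using HE by auto
  have three: "card {e, {u, c}, {v, c}} = 3" using c uv by (auto simp: doubleton_eq_iff)
  have H: "?H = {e, {u, c}, {v, c}}"
    using card_seteq[OF fin(1), of "{e, {u, c}, {v, c}}"] three card c eH by simp
  \<comment> \<open>The cycle through \<open>e\<close> inside \<open>?H'\<close> has length at most
    five, so it is the same triangle.\<close>
  have c': "{u, c} \<in> ?H'" "{v, c} \<in> ?H'"
    using boundary_path[OF e(1) uv cE eH(2) HE(2) nb(2) card(2)] by auto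
  define B where "B = E - {e}"
  define D where "D = host B e"
  have B: "B \<subseteq> E" "e \<notin> B" by (auto simp: B_def)
  have D: "D \<in> faces B" using host_face e B by (simp add: D_def)
  have "card (sides E e) = 2" using nonbridge_sides e by blast
  then have sides: "sides E e = {F, F'}"
    using F by (metis card_2_iff doubleton_eq_iff insert_iff singletonD)
  have "D - open_arc e = F \<union> F'" using Union_sides[OF e(1) order_refl] sides by (simp add: D_def B_def)
  then have D_sub: "D \<subseteq> F \<union> F' \<union> path_image (\<gamma> e)" unfolding open_arc_def by blast
  define H2 where "H2 = boundary B D"
  have H2B: "H2 \<subseteq> B" by (auto simp: H2_def boundary_def)
  \<comment> \<open>Since \<open>?H\<close> is contained in \<open>?H'\<close>, the open arc of an
    edge \<open>h\<close> outside \<open>?H'\<close> avoids the closures of \<open>F\<close> and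
    \<open>F'\<close> and the arc of \<open>e\<close>, which together cover the closure of
    \<open>D\<close>. Hence \<open>D\<close> survives the deletion of \<open>h\<close>.\<close>
  have H2: "H2 \<subseteq> ?H' - {e}"
  proof
    fix h assume h: "h \<in> H2"
    then have hB: "h \<in> B" "h \<in> E" "h \<noteq> e" using H2B B by (auto simp: B_def)
    have "h \<in> ?H'"
    proof (rule ccontr)
      assume "h \<notin> ?H'"
      then have "h \<notin> ?H" using H c' eH by auto
      have "F \<in> faces (E - {h})" "F' \<in> faces (E - {h})"
        using \<open>h \<notin> ?H'\<close> \<open>h \<notin> ?H\<close> hB by (auto simp: boundary_def)
      then have fr: "frontier F \<subseteq> pts (E - {h})" "frontier F' \<subseteq> pts (E - {h})"
        using frontier_face[of "E - {h}"] by auto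
      have arc_h: "open_arc h \<inter> pts (E - {h}) = {}" using open_arc_pts hB by auto
      have "open_arc h \<subseteq> pts E" using hB by (auto simp: pts_def)
      then have "open_arc h \<inter> F = {}" "open_arc h \<inter> F' = {}" using face_pts faces by blast+
      then have "open_arc h \<inter> closure F = {}" "open_arc h \<inter> closure F' = {}"
        using fr arc_h unfolding closure_Un_frontier by blast+
      moreover have "path_image (\<gamma> e) \<subseteq> pts (E - {h})"
        using pts_eq[of "E - {h}"] e hB by auto
      moreover have "closure D \<subseteq> closure F \<union> closure F' \<union> path_image (\<gamma> e)"
        using closure_mono[OF D_sub] closed_arc_image[OF arcs[OF e(1)]] by (simp add: closure_Un)
      ultimately have "open_arc h \<inter> closure D = {}" using arc_h by blast
      then have "open_arc h \<inter> frontier D = {}" by (auto simp: frontier_def)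
      moreover have "frontier D \<subseteq> pts B" using frontier_face[OF B(1) D] .
      moreover have "pts B = pts (B - {h}) \<union> open_arc h"
        using pts_insert[of h "B - {h}"] hB by (simp add: insert_absorb)
      ultimately have "frontier D \<subseteq> pts (B - {h})" by blast
      then have "D \<in> faces (B - {h})"
        using face_connected[OF D] face_nonempty[OF D] face_pts[OF D] pts_mono[of "B - {h}" B]
        by (intro faceI) auto
      then show False using h by (simp add: H2_def boundary_def)
    qed
    then show "h \<in> ?H' - {e}" using hB by simp
  qed
  have H2E: "H2 \<subseteq> E" using H2B B by blast
  have cH2: "card H2 \<le> 5"
    using card_mono[OF fin(2)] H2 card by (meson Diff_subset le_trans order_trans)
  have "card (faces E) = card (faces B) + 1" using card_faces_nonbridge[OF e(1) order_refl e(2)] by (simp add: B_def)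
  then have "card (faces B) > 1" using many by simp
  then have f1: "card (faces H2) > 1" using faces_boundary_gt_1[OF B(1) D] by (simp add: H2_def)
  have e_H2: "{u, v} \<notin> H2" using H2 uv by blast
  \<comment> \<open>A cycle through \<open>{u, c}\<close> within the at most five edges of
    \<open>H2\<close> would be the triangle, but its edge \<open>e\<close> is gone.\<close>
  have b1: "bridge H2 {u, c}" if "{u, c} \<in> H2"
    using boundary_path(1)[of "{u, c}" u c v H2] that cE e uv e_H2 H2E cH2 by (auto simp: insert_commute)
  have b2: "bridge H2 {v, c}" if "{v, c} \<in> H2"
    using boundary_path(1)[of "{v, c}" v c u H2] that cE e uv e_H2 H2E cH2 by (auto simp: insert_commute)
  \<comment> \<open>Deleting the two bridges keeps more than one face, so \<open>H3\<close> still
    contains a cycle. Yet it has at most 5 - 3 = 2 edges.\<close>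
  define H3 where "H3 = H2 - {{u, c}} - {{v, c}}"
  have "card (faces H3) = card (faces (H2 - {{u, c}}))"
    unfolding H3_def using b2 bridge_antimono[of H2 "{v, c}" "H2 - {{u, c}}"] H2E
    by (intro card_faces_Diff) auto
  also have "\<dots> = card (faces H2)" using b1 H2E by (intro card_faces_Diff) auto
  finally have "card (faces H3) > 1" using f1 by simp
  moreover have H3E: "H3 \<subseteq> E" using H2E by (auto simp: H3_def)
  ultimately obtain h where h: "h \<in> H3" "\<not> bridge H3 h" using nonbridge_exists by blast
  then obtain p q where pq: "h = {p, q}" using edges H3E by blast
  have "3 \<le> card H3" using cycle_path[OF h(1) H3E h(2) pq] by (metis le_trans)
  moreover have "H3 \<subseteq> ?H' - {e, {u, c}, {v, c}}" using H2 by (auto simp: H3_def)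
  then have "card H3 \<le> card (?H' - {e, {u, c}, {v, c}})" using fin(2) by (intro card_mono) auto
  moreover have "card (?H' - {e, {u, c}, {v, c}}) = card ?H' - 3"
    using three eH c' fin by (subst card_Diff_subset) auto
  ultimately show False using card(2) by simp
qed

text \<open>A bridge has one side and receives at most 1/3. More than two faces are required because
  a lone triangle bounds both of its faces and would give 1/3 + 1/3.\<close>

lemma sum_sides_le:
  assumes e: "e \<in> E" and many: "card (faces E) > 2"
  shows "(\<Sum>F\<in>sides E e. 1 / real (card (boundary E F))) \<le> 1 / 2"
proof -
  have ge3: "real (card (boundary E F)) \<ge> 3" if "F \<in> sides E e" for F
    using boundary_card_ge_3[of F] that many by (simp add: sides_def)
  show ?thesis
  proof (cases "bridge E e")
    case True
    then obtain F where F: "sides E e = {F}"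
      using card_sides_bridge[OF e order_refl] card_1_singletonE by blast
    then have "1 / real (card (boundary E F)) \<le> 1 / 2" using ge3[of F] by (simp add: field_simps)
    then show ?thesis using F by simp
  next
    case False
    then obtain F F' where F: "sides E e = {F, F'}" "F \<noteq> F'"
      using nonbridge_sides[OF e order_refl] by (metis card_2_iff)
    have "\<not> (card (boundary E F) \<le> 3 \<and> card (boundary E F') \<le> 5)"
      "\<not> (card (boundary E F') \<le> 3 \<and> card (boundary E F) \<le> 5)"
      using triangle_side[OF e False, of F F'] triangle_side[OF e False, of F' F] F many by auto
    then have "(real (card (boundary E F)) \<ge> 4 \<and> real (card (boundary E F')) \<ge> 4) \<or>
        real (card (boundary E F)) \<ge> 6 \<or> real (card (boundary E F')) \<ge> 6"
      by linarith
    then have "1 / real (card (boundary E F)) + 1 / real (card (boundary E F')) \<le> 1 / 2"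
    proof (elim disjE conjE)
      assume "real (card (boundary E F)) \<ge> 4" "real (card (boundary E F')) \<ge> 4"
      then have "1 / real (card (boundary E F)) \<le> 1 / 4" "1 / real (card (boundary E F')) \<le> 1 / 4"
        by (simp_all add: field_simps)
      then show ?thesis by simp
    next
      assume "real (card (boundary E F)) \<ge> 6"
      then have "1 / real (card (boundary E F)) \<le> 1 / 6" by (simp add: field_simps)
      moreover have "1 / real (card (boundary E F')) \<le> 1 / 3" using ge3[of F'] F by (simp add: field_simps)
      ultimately show ?thesis by simp
    next
      assume "real (card (boundary E F')) \<ge> 6"
      then have "1 / real (card (boundary E F')) \<le> 1 / 6" by (simp add: field_simps)
      moreover have "1 / real (card (boundary E F)) \<le> 1 / 3" using ge3[of F] F by (simp add: field_simps)
      ultimately show ?thesis by simp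
    qed
    then show ?thesis using F by simp
  qed
qed

lemma card_faces_le:
  assumes "card (faces E) > 2"
  shows "2 * card (faces E) \<le> card E"
proof -
  have B: "boundary E F = {e. e \<in> E \<and> e \<in> boundary E F}" for F by (auto simp: boundary_def)
  have S: "sides E e = {F. F \<in> faces E \<and> e \<in> boundary E F}" if "e \<in> E" for e
    using that by (auto simp: sides_def boundary_def)
  have "real (card (faces E)) = (\<Sum>F\<in>faces E. \<Sum>e\<in>boundary E F. 1 / real (card (boundary E F)))"
    using boundary_card_ge_3 assms by (subst real_of_card, intro sum.cong) fastforce+
  also have "\<dots> = (\<Sum>F\<in>faces E. \<Sum>e | e \<in> E \<and> e \<in> boundary E F. 1 / real (card (boundary E F)))"
    using B by simp
  also have "\<dots> = (\<Sum>e\<in>E. \<Sum>F | F \<in> faces E \<and> e \<in> boundary E F. 1 / real (card (boundary E F)))"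
    using finite_faces finite_E by (intro sum.swap_restrict) auto
  also have "\<dots> = (\<Sum>e\<in>E. \<Sum>F\<in>sides E e. 1 / real (card (boundary E F)))"
    using S by (intro sum.cong) auto
  also have "\<dots> \<le> (\<Sum>e\<in>E. 1 / 2)"
    using sum_sides_le assms by (intro sum_mono) auto
  finally show ?thesis by simp
qed

text \<open>With at most two faces Euler's inequality alone gives
  \<open>card E \<le> card V\<close>; otherwise \<open>card_faces_le\<close> applies.\<close>

lemma card_edges_less:
  assumes "V \<noteq> {}"
  shows "card E < 2 * card V"
proof -
  have "classes E \<noteq> {}" "finite (classes E)" using assms finite_V by (auto simp: classes_def)
  then have "card (classes E) \<ge> 1" by (simp add: card_gt_0_iff Suc_le_eq)
  moreover have "card V \<ge> 1" using assms finite_V by (simp add: card_gt_0_iff Suc_le_eq)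
  ultimately show ?thesis using euler[OF order_refl] card_faces_le by linarith
qed

end

section \<open>Independent sets in sparse graphs\<close>

definition induced :: "'a set set \<Rightarrow> 'a set \<Rightarrow> 'a set set" where
  "induced E W = {e \<in> E. e \<subseteq> W}"

definition nbrs :: "'a set set \<Rightarrow> 'a set \<Rightarrow> 'a \<Rightarrow> 'a set" where
  "nbrs E W x = {y \<in> W. {x, y} \<in> E}"

definition stable :: "'a set set \<Rightarrow> 'a set \<Rightarrow> bool" where
  "stable E S \<longleftrightarrow> (\<forall>u\<in>S. \<forall>v\<in>S. {u, v} \<notin> E)"

text \<open>Planarity and the 5-cycle condition survive only through \<open>sparse\<close>, stated
  for every vertex subset because the induction removes vertices.\<close>

locale sparse_graph =
  fixes V :: "'a set" and E :: "'a set set"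
  assumes finite_vertices: "finite V"
    and edge_pair: "e \<in> E \<Longrightarrow> \<exists>u v. u \<noteq> v \<and> e = {u, v}"
    and sparse: "W \<subseteq> V \<Longrightarrow> W \<noteq> {} \<Longrightarrow> card (induced E W) < 2 * card W"
    and no_diamond: "{a, b} \<in> E \<Longrightarrow> {b, c} \<in> E \<Longrightarrow> {a, c} \<in> E \<Longrightarrow> {b, d} \<in> E \<Longrightarrow> {a, d} \<in> E \<Longrightarrow> c = d"
begin

lemma no_loop: "{x} \<notin> E" "{x, x} \<notin> E"
  using edge_pair[of "{x}"] by auto

lemma finite_induced: "finite W \<Longrightarrow> finite (induced E W)"
  by (rule finite_subset[of _ "Pow W"]) (auto simp: induced_def)

lemma finite_nbrs: "finite W \<Longrightarrow> finite (nbrs E W x)"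
  by (simp add: nbrs_def)

lemma nbrs_Diff: "nbrs E (W - S) x = nbrs E W x - S"
  by (auto simp: nbrs_def)

lemma nbrsD:
  assumes "y \<in> nbrs E W x"
  shows "y \<in> W" "{x, y} \<in> E" "x \<noteq> y"
  using assms no_loop by (auto simp: nbrs_def)

lemma nbrs_sym: "x \<in> W \<Longrightarrow> y \<in> nbrs E W x \<Longrightarrow> x \<in> nbrs E W y"
  by (auto simp: nbrs_def insert_commute)

lemma nbrs_edges: "x \<in> W \<Longrightarrow> card {e \<in> induced E W. x \<in> e} = card (nbrs E W x)"
proof -
  assume x: "x \<in> W"
  have "{e \<in> induced E W. x \<in> e} = (\<lambda>y. {x, y}) ` nbrs E W x"
  proof (intro equalityI subsetI)
    fix e assume e: "e \<in> {e \<in> induced E W. x \<in> e}"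
    then obtain u v where "e = {u, v}" using edge_pair[of e] by (auto simp: induced_def)
    then show "e \<in> (\<lambda>y. {x, y}) ` nbrs E W x"
      using e by (auto simp: induced_def nbrs_def insert_commute)
  qed (use x in \<open>auto simp: induced_def nbrs_def\<close>)
  moreover have "inj_on (\<lambda>y. {x, y}) (nbrs E W x)"
    by (auto simp: inj_on_def doubleton_eq_iff)
  ultimately show ?thesis by (simp add: card_image)
qed

text \<open>Iterating this counts the edges that meet a set: each vertex removed contributes its
  degree in what is left.\<close>

lemma card_induced_remove:
  assumes "finite W" "x \<in> W"
  shows "card (induced E W) = card (induced E (W - {x})) + card (nbrs E W x)"
proof -
  have "induced E W = induced E (W - {x}) \<union> {e \<in> induced E W. x \<in> e}"
    by (auto simp: induced_def)
  moreover have "induced E (W - {x}) \<inter> {e \<in> induced E W. x \<in> e} = {}"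
    by (auto simp: induced_def)
  ultimately show ?thesis
    using card_Un_disjoint finite_induced assms nbrs_edges
    by (metis (no_types, lifting) finite_Diff finite_Un)
qed

lemma card_induced_remove_le:
  assumes "finite W"
  shows "card (induced E (W - S)) \<le> card (induced E W)"
  using finite_induced[OF assms] by (intro card_mono) (auto simp: induced_def)

lemma sum_nbrs:
  assumes "finite W"
  shows "(\<Sum>x\<in>W. card (nbrs E W x)) = 2 * card (induced E W)"
proof -
  have "card {x \<in> W. x \<in> e} = 2" if "e \<in> induced E W" for e
  proof -
    obtain u v where "u \<noteq> v" "e = {u, v}" using \<open>e \<in> induced E W\<close> edge_pair[of e] by (auto simp: induced_def)
    moreover from this \<open>e \<in> induced E W\<close> have "{x \<in> W. x \<in> e} = {u, v}" by (auto simp: induced_def)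
    ultimately show ?thesis by simp
  qed
  then have "(\<Sum>x\<in>W. card {e \<in> induced E W. x \<in> e}) = 2 * card (induced E W)"
    using assms finite_induced by (intro sum_multicount) auto
  then show ?thesis using nbrs_edges by simp
qed

text \<open>The average degree is below four.\<close>

lemma low_degree:
  assumes "W \<subseteq> V" "W \<noteq> {}"
  shows "\<exists>x\<in>W. card (nbrs E W x) \<le> 3"
proof (rule ccontr)
  assume "\<not> ?thesis"
  then have "(\<Sum>x\<in>W. 4) \<le> (\<Sum>x\<in>W. card (nbrs E W x))"
    by (intro sum_mono) force
  moreover have "finite W" using assms finite_vertices finite_subset by blast
  ultimately show False using sparse[OF assms] sum_nbrs by simp
qed

section \<open>The weighted induction on vertex subsets\<close>

definition good :: "'a set \<Rightarrow> bool" where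
  "good W \<longleftrightarrow> (\<exists>I\<subseteq>W. stable E I \<and> 41 * card W \<le> 7 * card (induced E W) + 102 * card I)"

text \<open>\<open>S\<close> contains the closed neighbourhood of \<open>J\<close>, so
  \<open>J\<close> can be added to any stable set of \<open>W - S\<close>. Here \<open>k\<close>
  bounds from below the number of edges that meet \<open>S\<close>.\<close>

lemma good_extend:
  assumes W: "finite W" "good (W - S)" "S \<subseteq> W"
    and J: "J \<subseteq> S" "stable E J" "\<And>x. x \<in> J \<Longrightarrow> nbrs E W x \<subseteq> S"
    and edges: "card (induced E W) \<ge> card (induced E (W - S)) + k"
    and count: "41 * card S \<le> 7 * k + 102 * card J"
  shows "good W"
proof -
  obtain I where I: "I \<subseteq> W - S" "stable E I"
    "41 * card (W - S) \<le> 7 * card (induced E (W - S)) + 102 * card I"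
    using W unfolding good_def by blast
  have "stable E (I \<union> J)"
  proof -
    have "{u, v} \<notin> E \<and> {v, u} \<notin> E" if "u \<in> J" "v \<in> I" for u v
      using J(3)[OF that(1)] that(2) I(1) by (auto simp: nbrs_def insert_commute)
    then show ?thesis using I(2) J(2) unfolding stable_def by blast
  qed
  moreover have fin: "finite S" "finite I" "finite J"
    using W I J by (meson finite_Diff finite_subset)+
  then have "card (I \<union> J) = card I + card J"
    using I J by (intro card_Un_disjoint) auto
  moreover have "card W = card (W - S) + card S"
    using W fin by (simp add: card_Diff_subset card_mono)
  moreover have "I \<union> J \<subseteq> W" using I J W by auto
  ultimately show ?thesis
    unfolding good_def using I(3) edges count by (intro exI[of _ "I \<union> J"]) auto
qed

text \<open>
  The closed neighbourhood of \<open>x\<close> meets only 8 edges, one too few for a single removal step. It is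
  removed together with the closed neighbourhood of a vertex \<open>p\<close> from the triangle at the neighbour
  \<open>c\<close> of \<open>x\<close> outside the triangle at \<open>x\<close>, which makes up for the deficit.
\<close>

lemma good_cubic_triangles:
  assumes fin: "finite W" and x: "x \<in> W"
    and IH: "\<And>S. S \<subseteq> W \<Longrightarrow> S \<noteq> {} \<Longrightarrow> good (W - S)"
    and deg: "card (nbrs E W x) = 3"
    and triangle: "\<And>x. x \<in> W \<Longrightarrow> card (nbrs E W x) = 3 \<Longrightarrow> \<exists>a b c. nbrs E W x = {a, b, c} \<and> {a, b} \<in> E \<and>
        card (nbrs E W a) = 3 \<and> card (nbrs E W b) = 3 \<and> card (nbrs E W c) = 3"
  shows "good W"
proof -
  have distinct: "p \<noteq> q" "p \<noteq> r" "q \<noteq> r" if "nbrs E W y = {p, q, r}" "card (nbrs E W y) = 3" for y p q r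
    using that by (auto simp: card_insert_if split: if_splits)
  obtain a b c where abc: "nbrs E W x = {a, b, c}" "{a, b} \<in> E"
      "card (nbrs E W a) = 3" "card (nbrs E W b) = 3" "card (nbrs E W c) = 3"
    using triangle[OF x deg] by blast
  have d1: "a \<noteq> b" "a \<noteq> c" "b \<noteq> c" using distinct[OF abc(1) deg] .
  have xE: "{x, a} \<in> E" "{x, b} \<in> E" "{x, c} \<in> E" "a \<in> W" "b \<in> W" "c \<in> W"
    "x \<noteq> a" "x \<noteq> b" "x \<noteq> c"
    using nbrsD[of _ W x] abc(1) by auto
  have nac: "{a, c} \<notin> E" "{b, c} \<notin> E"
    using no_diamond[of x a b c] no_diamond[of x b a c] abc(2) xE d1 by (auto simp: insert_commute)
  obtain p q r where pqr: "nbrs E W c = {p, q, r}" "{p, q} \<in> E"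
      "card (nbrs E W p) = 3" "card (nbrs E W q) = 3"
    using triangle[OF xE(6) abc(5)] by blast
  have d2: "p \<noteq> q" "p \<noteq> r" "q \<noteq> r" using distinct[OF pqr(1) abc(5)] .
  have cE: "{c, p} \<in> E" "{c, q} \<in> E" "p \<in> W" "q \<in> W" "c \<noteq> p" "c \<noteq> q"
    using nbrsD[of _ W c] pqr(1) by auto
  have x_only: "z = a \<or> z = b \<or> z = c" if "{x, z} \<in> E" "z \<in> W" for z
    using that abc(1) by (auto simp: nbrs_def)
  \<comment> \<open>If \<open>x\<close> were \<open>p\<close>, then \<open>q\<close> would be
    adjacent to both \<open>x\<close> and \<open>c\<close>; but no neighbour of \<open>x\<close> is
    adjacent to \<open>c\<close>. The same holds with \<open>p\<close> and \<open>q\<close>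
    exchanged.\<close>
  have "x \<in> {p, q, r}" using nbrs_sym[OF x, of c] abc(1) pqr(1) by auto
  moreover have "x \<noteq> p" using x_only[of q] pqr(2) cE nac by (auto simp: insert_commute)
  moreover have "x \<noteq> q" using x_only[of p] pqr(2) cE nac by (auto simp: insert_commute)
  ultimately have r: "r = x" by auto
  have new: "p \<notin> {x, a, b, c}" "q \<notin> {x, a, b, c}"
    using cE nac d2 r by (auto simp: insert_commute)
  define W2 where "W2 = W - {x, a, b, c}"
  have fin2: "finite W2" using fin by (simp add: W2_def)
  \<comment> \<open>Removing \<open>x\<close>, \<open>a\<close>, \<open>b\<close>, \<open>c\<close>
    in turn deletes 3 + 2 + 1 + 2 edges. This alone is too little: 4 * 41 = 164 > 8 * 7 + 102 =
    158.\<close>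
  have e8: "card (induced E W) = card (induced E W2) + 8"
  proof -
    have na: "card (nbrs E W a - {x}) = 2"
      using nbrs_sym[OF x, of a] abc(1,3) by simp
    have "x \<in> nbrs E W b" "a \<in> nbrs E W b"
      using nbrs_sym[OF x, of b] abc(1,2) xE by (auto simp: nbrs_def insert_commute)
    then have nb: "card (nbrs E W b - {x} - {a}) = 1" using abc(4) xE by (simp add: finite_nbrs)
    have "nbrs E W c - {x} - {a} - {b} = {p, q}" using pqr(1) r new by auto
    then have nc: "card (nbrs E W c - {x} - {a} - {b}) = 2" using d2 by simp
    have "card (induced E W) = card (induced E (W - {x})) + 3"
      using card_induced_remove[OF fin x] deg by simp
    moreover have "card (induced E (W - {x})) = card (induced E (W - {x} - {a})) + 2"
      using card_induced_remove[of "W - {x}" a] na fin xE by (simp add: nbrs_Diff)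
    moreover have "card (induced E (W - {x} - {a})) = card (induced E (W - {x} - {a} - {b})) + 1"
      using card_induced_remove[of "W - {x} - {a}" b] nb fin xE d1 by (simp add: nbrs_Diff)
    moreover have "card (induced E (W - {x} - {a} - {b})) = card (induced E (W - {x} - {a} - {b} - {c})) + 2"
      using card_induced_remove[of "W - {x} - {a} - {b}" c] nc fin xE d1 by (simp add: nbrs_Diff)
    moreover have "W - {x} - {a} - {b} - {c} = W2" by (auto simp: W2_def)
    ultimately show ?thesis by simp
  qed
  have pn: "c \<in> nbrs E W p" "q \<in> nbrs E W p"
    using cE pqr(2) xE by (auto simp: nbrs_def insert_commute)
  obtain d where d: "nbrs E W p = {c, q, d}" "d \<noteq> c" "d \<noteq> q"
  proof -
    have "card (nbrs E W p - {c} - {q}) = 1" using pn pqr(3) cE by (simp add: finite_nbrs)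
    then obtain d where "nbrs E W p - {c} - {q} = {d}" by (meson card_1_singletonE)
    then show thesis using pn that[of d] by blast
  qed
  have dE: "{p, d} \<in> E" "d \<in> W" "d \<noteq> p" using nbrsD[of d W p] d(1) by auto
  have nxp: "{x, p} \<notin> E" using x_only[of p] cE new by auto
  have dx: "d \<noteq> x" using dE nxp by (auto simp: insert_commute)
  have J: "stable E {x, p}" "card {x, p} = 2"
    using nxp no_loop new by (auto simp: stable_def insert_commute)
  show ?thesis
  proof (cases "d \<in> {a, b}")
    case True
    \<comment> \<open>The closed neighbourhoods of \<open>x\<close> and \<open>p\<close> overlap in
      \<open>c\<close> and \<open>d\<close>, so the eight edges suffice: 6 * 41 = 246 \<le> 8 * 7 +
      2 * 102 = 260.\<close>
    let ?S = "{x, a, b, c, p, q}"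
    have "card (induced E (W - ?S)) \<le> card (induced E W2)"
    proof -
      have "W - ?S = W2 - {p, q}" by (auto simp: W2_def)
      then show ?thesis using card_induced_remove_le[OF fin2] by simp
    qed
    moreover have "card ?S = 6" using new d1 d2 xE by auto
    ultimately show ?thesis
      using good_extend[OF fin IH, of ?S "{x, p}" 8] J e8 abc(1) d(1) True x xE cE by auto
  next
    case False
    \<comment> \<open>Seven vertices call for twelve edges: 7 * 41 = 287 \<le> 12 * 7 + 2 * 102 =
      288. Beyond the eight, two are \<open>{p, q}\<close> and \<open>{p, d}\<close>, and two join
      \<open>d\<close> to its partners \<open>s\<close> and \<open>t\<close> in a triangle.\<close>
    let ?S = "{x, a, b, c, p, q, d}"
    have dnew: "d \<notin> {x, a, b, c, p, q}" using False d dE dx by auto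
    obtain s t u where stu: "nbrs E W d = {s, t, u}" "{s, t} \<in> E" "card (nbrs E W d) = 3"
    proof -
      have "card (nbrs E W d) = 3"
        using triangle[OF cE(3) pqr(3)] d(1) by (metis insert_iff singletonD)
      then show thesis using triangle[OF dE(2)] that by blast
    qed
    have d3: "s \<noteq> t" "s \<noteq> u" "t \<noteq> u" using distinct[OF stu(1,3)] .
    have sE: "{d, s} \<in> E" "{d, t} \<in> E" "s \<in> W" "t \<in> W" using nbrsD[of _ W d] stu(1) by auto
    have dq: "{d, q} \<notin> E"
      using no_diamond[of p q c d] pqr(2) cE(1,2) dE(1) d(2) by (metis insert_commute)
    have dc: "{d, c} \<notin> E"
    proof
      assume "{d, c} \<in> E"
      then have "d \<in> nbrs E W c" using dE(2) by (simp add: nbrs_def insert_commute)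
      then show False using pqr(1) r dnew by auto
    qed
    have dx': "{d, x} \<notin> E" using x_only[of d] dE(2) dnew by (metis insert_iff insert_commute)
    have p_only: "z = c \<or> z = q \<or> z = d" if "{p, z} \<in> E" "z \<in> W" for z
      using that d(1) by (auto simp: nbrs_def)
    \<comment> \<open>Within \<open>W\<close>, \<open>p\<close> is adjacent only to
      \<open>c\<close>, \<open>q\<close> and \<open>d\<close>, and \<open>d\<close> is adjacent to
      neither \<open>c\<close> nor \<open>q\<close>. So the triangle \<open>d\<close>,
      \<open>s\<close>, \<open>t\<close> avoids \<open>p\<close>.\<close>
    have "p \<in> {s, t, u}" using nbrs_sym[OF cE(3), of d] d(1) stu(1) by simp
    moreover have "p \<noteq> s"
    proof
      assume "p = s"
      then have "t = c \<or> t = q \<or> t = d" using p_only[of t] stu(2) sE(4) by simp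
      then show False using sE(2) dq dc no_loop by auto
    qed
    moreover have "p \<noteq> t"
    proof
      assume "p = t"
      then have "s = c \<or> s = q \<or> s = d" using p_only[of s] stu(2) sE(3) by (simp add: insert_commute)
      then show False using sE(1) dq dc no_loop by auto
    qed
    ultimately have u: "u = p" by auto
    have ab_d: "\<not> ({d, a} \<in> E \<and> {d, b} \<in> E)"
      using no_diamond[of a b x d] abc(2) xE dnew by (auto simp: insert_commute)
    have a_only: "z = x \<or> z = b \<or> z = d" if "{a, z} \<in> E" "{a, d} \<in> E" "z \<in> W" for z
    proof -
      have "{x, b, d} \<subseteq> nbrs E W a" using that xE abc(2) dE x by (auto simp: nbrs_def insert_commute)
      moreover have "card {x, b, d} = 3" using xE dnew by auto
      ultimately have "nbrs E W a = {x, b, d}" using abc(3) card_seteq[OF finite_nbrs[OF fin]] by (metis order_refl)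
      then show ?thesis using that by (auto simp: nbrs_def)
    qed
    have b_only: "z = x \<or> z = a \<or> z = d" if "{b, z} \<in> E" "{b, d} \<in> E" "z \<in> W" for z
    proof -
      have "{x, a, d} \<subseteq> nbrs E W b" using that xE abc(2) dE x by (auto simp: nbrs_def insert_commute)
      moreover have "card {x, a, d} = 3" using xE dnew by auto
      ultimately have "nbrs E W b = {x, a, d}" using abc(4) card_seteq[OF finite_nbrs[OF fin]] by (metis order_refl)
      then show ?thesis using that by (auto simp: nbrs_def)
    qed
    \<comment> \<open>If \<open>s\<close> were \<open>a\<close>, the neighbours of \<open>a\<close>
      would be \<open>x\<close>, \<open>b\<close>, \<open>d\<close>, and \<open>t\<close> would be
      one of them; none of these can be adjacent to \<open>d\<close> along with \<open>a\<close>.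
      Hence \<open>{d, s}\<close> and \<open>{d, t}\<close> are not among the eight edges.\<close>
    have st_ab: "s \<noteq> a" "t \<noteq> a" "s \<noteq> b" "t \<noteq> b"
      using a_only[of t] a_only[of s] b_only[of t] b_only[of s] stu(2) sE ab_d dx' no_loop
      by (metis insert_commute)+
    have "nbrs E W d - {x, a, b, c} - {p} - {q} = {s, t}"
      using stu(1) u st_ab sE dx' dc dq d3 by (auto simp: insert_commute)
    then have nd: "card (nbrs E W d - {x, a, b, c} - {p} - {q}) = 2" using d3 by simp
    have "nbrs E W p - {x, a, b, c} = {q, d}" using d dnew new by auto
    then have np: "card (nbrs E W p - {x, a, b, c}) = 2" using d by simp
    have "card (induced E W2) = card (induced E (W2 - {p})) + 2"
      using card_induced_remove[of W2 p] fin2 np new cE by (simp add: W2_def nbrs_Diff)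
    moreover have "card (induced E (W2 - {p} - {q})) \<le> card (induced E (W2 - {p}))"
      using card_induced_remove_le fin2 by simp
    moreover have "card (induced E (W2 - {p} - {q})) = card (induced E (W2 - {p} - {q} - {d})) + 2"
      using card_induced_remove[of "W2 - {p} - {q}" d] fin2 nd dnew dE by (simp add: W2_def nbrs_Diff)
    moreover have "W2 - {p} - {q} - {d} = W - ?S" by (auto simp: W2_def)
    ultimately have "card (induced E W) \<ge> card (induced E (W - ?S)) + 12" using e8 by simp
    moreover have "card ?S = 7" using new d1 d2 xE dnew by auto
    ultimately show ?thesis
      using good_extend[OF fin IH, of ?S "{x, p}" 12] J abc(1) d(1) x xE cE dE by auto
  qed
qed

text \<open>For a vertex of degree at most one no edge has to be counted, since 2 * 41 \<le> 102. If
  all degrees are at least three, \<open>low_degree\<close> supplies a cubic vertex, and failure of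
  the nine-edge count at every cubic vertex leaves the configuration of
  \<open>good_cubic_triangles\<close>.\<close>

lemma stable_set_exists: "W \<subseteq> V \<Longrightarrow> good W"
proof (induction "card W" arbitrary: W rule: less_induct)
  case less
  have fin: "finite W" using less.prems finite_vertices finite_subset by blast
  have IH: "good (W - S)" if "S \<subseteq> W" "S \<noteq> {}" for S
  proof (rule less.hyps)
    show "card (W - S) < card W" using that by (intro psubset_card_mono[OF fin]) blast
  qed (use less.prems in blast)
  show ?case
  proof (cases "W = {}")
    case True
    then show ?thesis by (auto simp: good_def stable_def)
  next
    case False
    let ?d = "\<lambda>x. card (nbrs E W x)"
    have single: "stable E {x}" for x using no_loop by (simp add: stable_def)
    show ?thesis
    proof (cases "\<exists>x\<in>W. ?d x \<le> 1")
      case True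
      then obtain x where x: "x \<in> W" "?d x \<le> 1" by blast
      have S: "insert x (nbrs E W x) \<subseteq> W" using x by (auto simp: nbrs_def)
      have "card (insert x (nbrs E W x)) \<le> 2" using x(2) by (simp add: card_insert_if finite_nbrs[OF fin])
      then show ?thesis
        using good_extend[OF fin IH S, of "{x}" 0] S single
          card_induced_remove_le[OF fin] by auto
    next
      case ge2: False
      show ?thesis
      proof (cases "\<exists>x\<in>W. ?d x = 2")
        case True
        then obtain x where x: "x \<in> W" "?d x = 2" by blast
        then obtain a b where ab: "nbrs E W x = {a, b}" "a \<noteq> b" by (meson card_2_iff)
        have W: "a \<in> W" "b \<in> W" "x \<noteq> a" "x \<noteq> b" using ab(1) nbrsD[of _ W x] by auto
        have "x \<in> nbrs E W a" using nbrs_sym[OF x(1)] ab by simp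
        \<comment> \<open>As all degrees are at least two, \<open>a\<close> has a neighbour besides
          \<open>x\<close>. This is the third edge, and 3 * 41 = 3 * 7 + 102 is an equality.\<close>
        then have na: "card (nbrs E W a - {x}) \<ge> 1" using ge2 W by (simp add: finite_nbrs[OF fin]) fastforce
        have "card (induced E W) = card (induced E (W - {x})) + 2"
          using card_induced_remove[OF fin x(1)] x by simp
        moreover have "card (induced E (W - {x})) \<ge> card (induced E (W - {x} - {a})) + 1"
          using card_induced_remove[of "W - {x}" a] na fin W by (simp add: nbrs_Diff)
        moreover have "card (induced E (W - {x} - {a} - {b})) \<le> card (induced E (W - {x} - {a}))"
          using card_induced_remove_le fin by simp
        moreover have "W - {x} - {a} - {b} = W - {x, a, b}" by auto
        ultimately have "card (induced E W) \<ge> card (induced E (W - {x, a, b})) + 3" by simp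
        then show ?thesis
          using good_extend[OF fin IH, of "{x, a, b}" "{x}" 3] single W x ab by auto
      next
        case ne2: False
        have ge3: "?d x \<ge> 3" if "x \<in> W" for x using ge2 ne2 that
          by (metis One_nat_def Suc_1 not_less_eq_eq numeral_3_eq_3 le_antisym)
        obtain y where y: "y \<in> W" "?d y = 3" using low_degree[OF less.prems False] ge3 by (meson le_antisym)
        have big: "good W" if x: "x \<in> W" "?d x = 3" and abc: "nbrs E W x = {a, b, c}"
          and edges: "card (nbrs E W a - {x}) + card (nbrs E W b - {x} - {a}) + card (nbrs E W c - {x} - {a} - {b}) \<ge> 6"
          for x a b c
        proof -
          have d: "a \<noteq> b" "a \<noteq> c" "b \<noteq> c" using x(2) abc by (auto simp: card_insert_if split: if_splits)
          have W: "a \<in> W" "b \<in> W" "c \<in> W" "x \<noteq> a" "x \<noteq> b" "x \<noteq> c" using abc nbrsD[of _ W x] by auto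
          have "card (induced E W) = card (induced E (W - {x})) + 3"
            using card_induced_remove[OF fin x(1)] x by simp
          moreover have "card (induced E (W - {x})) = card (induced E (W - {x} - {a})) + card (nbrs E W a - {x})"
            using card_induced_remove[of "W - {x}" a] fin W by (simp add: nbrs_Diff)
          moreover have "card (induced E (W - {x} - {a})) =
              card (induced E (W - {x} - {a} - {b})) + card (nbrs E W b - {x} - {a})"
            using card_induced_remove[of "W - {x} - {a}" b] fin W d by (simp add: nbrs_Diff)
          moreover have "card (induced E (W - {x} - {a} - {b})) =
              card (induced E (W - {x} - {a} - {b} - {c})) + card (nbrs E W c - {x} - {a} - {b})"
            using card_induced_remove[of "W - {x} - {a} - {b}" c] fin W d by (simp add: nbrs_Diff)
          moreover have "W - {x} - {a} - {b} - {c} = W - {x, a, b, c}" by auto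
          ultimately have "card (induced E W) \<ge> card (induced E (W - {x, a, b, c})) + 9" using edges by simp
          moreover have "card {x, a, b, c} = 4" using W d by auto
          ultimately show ?thesis
            using good_extend[OF fin IH, of "{x, a, b, c}" "{x}" 9] single W x abc by auto
        qed
        have dm: "card (nbrs E W z - {x}) = ?d z - 1" if "x \<in> W" "z \<in> nbrs E W x" for x z
          using nbrs_sym[OF that] by simp
        show ?thesis
        proof (rule ccontr)
          assume bad: "\<not> good W"
          have "\<exists>a b c. nbrs E W x = {a, b, c} \<and> {a, b} \<in> E \<and> ?d a = 3 \<and> ?d b = 3 \<and> ?d c = 3"
            if x: "x \<in> W" "?d x = 3" for x
          proof -
            obtain a b c where abc: "nbrs E W x = {a, b, c}" "a \<noteq> b" "a \<noteq> c" "b \<noteq> c"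
              using x(2) by (auto simp: card_3_iff)
            have W: "a \<in> W" "b \<in> W" "c \<in> W" using abc(1) by (auto simp: nbrs_def)
            have minus: "card (nbrs E W a - {x}) = ?d a - 1" "card (nbrs E W b - {x}) = ?d b - 1"
              "card (nbrs E W c - {x}) = ?d c - 1"
              using dm[OF x(1)] abc(1) by auto
            have "{a, b} \<in> E \<or> {b, c} \<in> E \<or> {a, c} \<in> E"
            proof (rule ccontr)
              assume no: "\<not> ?thesis"
              then have "nbrs E W b - {x} - {a} = nbrs E W b - {x}"
                "nbrs E W c - {x} - {a} - {b} = nbrs E W c - {x}"
                by (auto simp: nbrs_def insert_commute)
              then have "card (nbrs E W a - {x}) + card (nbrs E W b - {x} - {a}) +
                  card (nbrs E W c - {x} - {a} - {b}) \<ge> 6"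
                using minus ge3[of a] ge3[of b] ge3[of c] W by simp
              then show False using bad big[OF x abc(1)] by blast
            qed
            then obtain a' b' c' where n: "nbrs E W x = {a', b', c'}" and e: "{a', b'} \<in> E"
              and dist: "a' \<noteq> b'" "a' \<noteq> c'" "b' \<noteq> c'"
            proof (elim disjE)
              assume "{a, b} \<in> E"
              then show thesis using that[of a b c] abc by simp
            next
              assume "{b, c} \<in> E"
              then show thesis using that[of b c a] abc by (simp add: insert_commute)
            next
              assume "{a, c} \<in> E"
              then show thesis using that[of a c b] abc by (simp add: insert_commute)
            qed
            have W': "a' \<in> W" "b' \<in> W" "c' \<in> W" "{x, a'} \<in> E" "{x, b'} \<in> E" "{x, c'} \<in> E"
              using n by (auto simp: nbrs_def)
            have no: "{a', c'} \<notin> E" "{b', c'} \<notin> E"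
              using no_diamond[of x a' b' c'] no_diamond[of x b' a' c'] e W' dist by (auto simp: insert_commute)
            then have "nbrs E W c' - {x} - {a'} - {b'} = nbrs E W c' - {x}"
              by (auto simp: nbrs_def insert_commute)
            moreover have "card (nbrs E W b' - {x} - {a'}) \<ge> ?d b' - 2"
              using dm[OF x(1), of b'] n diff_card_le_card_Diff[of "{a'}" "nbrs E W b' - {x}"] by simp
            \<comment> \<open>The edges beyond the three at \<open>x\<close> number at least
              \<open>(?d a' - 1) + (?d b' - 2) + (?d c' - 1)\<close>, which must stay below six.
              Degrees of at least three with sum below ten are all three.\<close>
            ultimately have "?d a' + ?d b' + ?d c' < 10"
              using bad big[OF x n] dm[OF x(1), of a'] dm[OF x(1), of c'] n ge3[of a'] ge3[of b'] ge3[of c'] W'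
              by fastforce
            then show ?thesis using n e ge3[OF W'(1)] ge3[OF W'(2)] ge3[OF W'(3)]
              by (intro exI[of _ a'] exI[of _ b'] exI[of _ c']) auto
          qed
          then show False using bad good_cubic_triangles[OF fin y(1) IH y(2)] by blast
        qed
      qed
    qed
  qed
qed

end

section \<open>From pair graphs to plane graphs\<close>

lemma (in pair_graph) edge_set_iff:
  shows "{u, v} \<in> edge_set (parcs G) \<longleftrightarrow> (u, v) \<in> parcs G"
    and "{u, v} \<in> edge_set (parcs G) \<longleftrightarrow> (v, u) \<in> parcs G"
proof -
  have "(y, x) \<in> parcs G \<Longrightarrow> (x, y) \<in> parcs G" for x y
    using pair_sym_arcs by (auto simp: symmetric_def dest: symD)
  then show "{u, v} \<in> edge_set (parcs G) \<longleftrightarrow> (u, v) \<in> parcs G"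
      "{u, v} \<in> edge_set (parcs G) \<longleftrightarrow> (v, u) \<in> parcs G"
    unfolding edge_set_def by (auto simp: doubleton_eq_iff image_iff Bex_def)
qed

lemma (in pair_graph) plane_subgraph:
  assumes "plane_drawing G f \<gamma>" "W \<subseteq> pverts G"
  shows "plane_graph W (induced (edge_set (parcs G)) W) f \<gamma>"
proof
  let ?E = "edge_set (parcs G)"
  note D = assms(1)[unfolded plane_drawing_def]
  note De = bspec[OF conjunct2[OF D]]
  show "finite W" using assms(2) pair_finite_verts finite_subset by blast
  show "inj_on f W" using D assms(2) inj_on_subset by blast
  fix e assume "e \<in> induced ?E W"
  then have e: "e \<in> ?E" "e \<subseteq> W" by (auto simp: induced_def)
  then obtain u v where uv: "(u, v) \<in> parcs G" "e = {u, v}" by (auto simp: edge_set_def)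
  then have "u \<noteq> v" using pair_no_loops by fastforce
  then show "\<exists>u v. u \<in> W \<and> v \<in> W \<and> u \<noteq> v \<and> e = {u, v}" using uv e by blast
  show "Path_Connected.arc (\<gamma> e)" "{pathstart (\<gamma> e), pathfinish (\<gamma> e)} = f ` e" 
    using De[OF e(1)] by simp_all
  have "(path_image (\<gamma> e) - f ` e) \<inter> f ` pverts G = {}" using De[OF e(1)] by simp
  then show "(path_image (\<gamma> e) - f ` e) \<inter> f ` W = {}" using assms(2) by blast
  fix e' assume "e' \<in> induced ?E W" "e' \<noteq> e"
  then show "(path_image (\<gamma> e) - f ` e) \<inter> path_image (\<gamma> e') = {}"
    using De[OF e(1)] by (simp add: induced_def)
qed

lemma (in pair_graph) cycle_3:
  assumes "(a, b) \<in> parcs G" "(b, c) \<in> parcs G" "(c, a) \<in> parcs G"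
  shows "cycle_of_length G 3 [(a, b), (b, c), (c, a)]"
proof -
  have "a \<noteq> b" "b \<noteq> c" "c \<noteq> a" using assms pair_no_loops by fastforce+
  then show ?thesis
    using assms unfolding cycle_of_length_def cycle_def awalk_def
    by (auto intro!: exI[of _ a] dest: wellformed')
qed

lemma (in pair_graph) cycle_5:
  assumes "(a, b) \<in> parcs G" "(b, c) \<in> parcs G" "(c, d) \<in> parcs G" "(d, e) \<in> parcs G" "(e, a) \<in> parcs G"
    "distinct [a, b, c, d, e]"
  shows "cycle_of_length G 5 [(a, b), (b, c), (c, d), (d, e), (e, a)]"
  using assms unfolding cycle_of_length_def cycle_def awalk_def
  by (auto intro!: exI[of _ a] dest: wellformed')

lemma adjacent_cyclesI:
  assumes "e \<in> edge_set (set p)" "e \<notin> edge_set (set q)"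
    and "h \<in> edge_set (set p)" "h \<in> edge_set (set q)"
  shows "adjacent_cycles p q" "adjacent_cycles q p"
  using assms unfolding adjacent_cycles_def by blast+

lemma independence_number_ge:
  assumes "finite (pverts G)" "independent_set G S"
  shows "card S \<le> independence_number G"
proof -
  have "{card S | S. independent_set G S} \<subseteq> card ` Pow (pverts G)"
    by (auto simp: independent_set_def)
  then have "finite {card S | S. independent_set G S}"
    using assms(1) finite_subset by blast
  then show ?thesis unfolding independence_number_def using assms(2) by (intro Max_ge) auto
qed

theorem theorem1p4:
  fixes G :: "'a pair_pre_digraph"
  assumes "pair_graph G"
    and "pverts G \<noteq> {}"
    and "planar G"
    and "\<And>p q. cycle_of_length G 3 p \<Longrightarrow> cycle_of_length G 3 q \<Longrightarrow> \<not> adjacent_cycles p q"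
    and "\<And>p q. cycle_of_length G 3 p \<Longrightarrow> cycle_of_length G 5 q \<Longrightarrow> \<not> adjacent_cycles p q"
  shows "real (card (pverts G)) / real (independence_number G) \<le> 4 - 2 / 9"
proof -
  interpret pair_graph G by fact
  let ?E = "edge_set (parcs G)" and ?V = "pverts G"
  obtain f \<gamma> where D: "plane_drawing G f \<gamma>" using assms(3) unfolding planar_def by blast
  have edges: "\<exists>u v. u \<noteq> v \<and> e = {u, v}" "e \<subseteq> ?V" if "e \<in> ?E" for e
    using that pair_no_loops wellformed' by (fastforce simp: edge_set_def)+
  have diamond: "c = d"
    if "{a, b} \<in> ?E" "{b, c} \<in> ?E" "{a, c} \<in> ?E" "{b, d} \<in> ?E" "{a, d} \<in> ?E" for a b c d
  proof (rule ccontr)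
    assume "c \<noteq> d"
    have arcs: "(a, b) \<in> parcs G" "(b, c) \<in> parcs G" "(c, a) \<in> parcs G" "(b, d) \<in> parcs G" "(d, a) \<in> parcs G"
      using that edge_set_iff by blast+
    then have "a \<noteq> b" "b \<noteq> c" "c \<noteq> a" "b \<noteq> d" "d \<noteq> a" using pair_no_loops by fastforce+
    then have "{b, c} \<notin> {{a, b}, {b, d}, {d, a}}" using \<open>c \<noteq> d\<close> by (auto simp: doubleton_eq_iff)
    then have "adjacent_cycles [(a, b), (b, c), (c, a)] [(a, b), (b, d), (d, a)]"
      by (intro adjacent_cyclesI(1)[where e = "{b, c}" and h = "{a, b}"]) (simp_all add: edge_set_def)
    with assms(4)[OF cycle_3[OF arcs(1-3)] cycle_3[OF arcs(1,4,5)]] show False by (rule notE)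
  qed
  have five: False
    if "{a, b} \<in> ?E" "{b, c} \<in> ?E" "{a, c} \<in> ?E" "distinct [a, b, x, y, z]"
      "{b, x} \<in> ?E" "{x, y} \<in> ?E" "{y, z} \<in> ?E" "{a, z} \<in> ?E" for a b c x y z
  proof -
    have arcs: "(a, b) \<in> parcs G" "(b, c) \<in> parcs G" "(c, a) \<in> parcs G" "(b, x) \<in> parcs G"
      "(x, y) \<in> parcs G" "(y, z) \<in> parcs G" "(z, a) \<in> parcs G"
      using that edge_set_iff by blast+
    \<comment> \<open>Every edge of the triangle contains \<open>a\<close> or \<open>b\<close>,
      while \<open>x\<close> and \<open>y\<close> differ from both. This distinguishes the cycles
      even if \<open>c\<close> is \<open>x\<close>, \<open>y\<close> or \<open>z\<close>.\<close>
    have "{x, y} \<notin> {{a, b}, {b, c}, {c, a}}" using that(4) by (auto simp: doubleton_eq_iff)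
    then have "adjacent_cycles [(a, b), (b, c), (c, a)] [(a, b), (b, x), (x, y), (y, z), (z, a)]"
      by (intro adjacent_cyclesI(2)[where e = "{x, y}" and h = "{a, b}"]) (simp_all add: edge_set_def)
    with assms(5)[OF cycle_3[OF arcs(1-3)] cycle_5[OF arcs(1,4-7) that(4)]] show False by (rule notE)
  qed
  have sparse: "card (induced ?E W) < 2 * card W" if W: "W \<subseteq> ?V" "W \<noteq> {}" for W
  proof -
    interpret H: plane_graph W "induced ?E W" f \<gamma> using plane_subgraph D W by blast
    interpret H: sparse_plane_graph W "induced ?E W" f \<gamma>
    proof
      show "c = d" if "{a, b} \<in> induced ?E W" "{b, c} \<in> induced ?E W" "{a, c} \<in> induced ?E W"
          "{b, d} \<in> induced ?E W" "{a, d} \<in> induced ?E W" for a b c d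
        using diamond[of a b c d] that by (simp add: induced_def)
      show False if "{a, b} \<in> induced ?E W" "{b, c} \<in> induced ?E W" "{a, c} \<in> induced ?E W"
          "distinct [a, b, x, y, z]" "{b, x} \<in> induced ?E W" "{x, y} \<in> induced ?E W"
          "{y, z} \<in> induced ?E W" "{a, z} \<in> induced ?E W" for a b c x y z
        using five[of a b c x y z] that by (simp add: induced_def)
    qed
    show ?thesis using H.card_edges_less W by blast
  qed
  interpret S: sparse_graph ?V ?E
    by (rule sparse_graph.intro[OF pair_finite_verts edges(1) sparse diamond])
  obtain I where I: "I \<subseteq> ?V" "stable ?E I" "41 * card ?V \<le> 7 * card (induced ?E ?V) + 102 * card I"
    using S.stable_set_exists[OF order_refl] unfolding S.good_def by blast
  have "independent_set G I"
    using I edge_set_iff unfolding independent_set_def stable_def by blast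
  then have "card I \<le> independence_number G"
    using independence_number_ge pair_finite_verts by blast
  moreover have "card (induced ?E ?V) < 2 * card ?V" using sparse assms(2) by blast
  ultimately have "9 * card ?V \<le> 34 * independence_number G" using I(3) by linarith
  then have "9 * real (card ?V) \<le> 34 * real (independence_number G)"
    by (metis of_nat_le_iff of_nat_mult of_nat_numeral)
  \<comment> \<open>For a zero denominator the quotient is 0 by convention; otherwise 34/9 = 4 -
    2/9.\<close>
  then show ?thesis by (cases "independence_number G = 0") (simp_all add: field_simps)
qed

end
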